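(* Let $(L,d,[\cdot,\cdot])$ be a differential graded Lie algebra over $\mathbb{K}$ with differential $d$ of degree $+1$, and let $\eta:L\to L$ be a map of degree $-1$ with $d\eta d=d$, $\eta^2=0$ and $\eta d\eta=\eta$. Let $[d,\eta]=d\eta+\eta d$, $H:=\{x\in L:(1-[d,\eta])x=x\}=\ker [d,\eta]$ (which is identified with the cohomology $H(L)$ of $(L,d)$), and $g:=\eta\circ[\cdot,\cdot]:L\otimes L\to L$. Then the following graded anti-symmetric maps $\mu_n:H^{\otimes n}\to H$ of degree $2-n$ define the structure of an $L_\infty$-algebra on $H$: $$\mu_1:=0,\qquad \mu_2:=(1-d\eta)[\cdot,\cdot],\qquad \mu_n:=\Big(-\tfrac12\Big)^{n-1}\sum_{\phi\in \mathrm{Ot}(n)}e(\phi)\,\phi\big((1-[d,\eta])[\cdot,\cdot],g,\ldots,g\big)\circ\alpha_n\quad(n\ge 2).$$ Here $\phi((1-[d,\eta])[\cdot,\cdot],g,\ldots,g)$ is the $n$-linear map obtained by assigning the bilinear map $(1-[d,\eta])[\cdot,\cdot]$ to the root of $\phi$ and the bilinear map $g$ to every other ramification.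
   Context: $\mathbb{K}$ is a commutative ring of characteristic zero containing $\mathbb{Q}$; all modules are $\mathbb{Z}$-graded. In exponents of $-1$ a homogeneous element or map stands for its degree, and $ab$ for the product of degrees. Koszul convention: $(f\otimes g)(a\otimes b)=(-1)^{g a}f(a)\otimes g(b)$. Signs. $\bigwedge^n V$ is the quotient of $V^{\otimes n}$ by the relations $a\otimes b+(-1)^{ab}b\otimes a$. For $\sigma\in\Sigma_n$, $\chi(\sigma)=\chi(\sigma,a_1,\ldots,a_n)$ is the sign with $a_{\sigma(1)}\wedge\cdots\wedge a_{\sigma(n)}=\chi(\sigma)a_1\wedge\cdots\wedge a_n$. The anti-symmetrization map is $\alpha_n(v_1\otimes\cdots\otimes v_n)=\sum_{\sigma\in\Sigma_n}\chi(\sigma)v_{\sigma(1)}\otimes\cdots\otimes v_{\sigma(n)}$. A map on $V^{\otimes n}$ is graded anti-symmetric if it factors through $\bigwedge^nV$. $\mathrm{Sh}(k,n)$ is the set of $\sigma\in\Sigma_n$ with $\sigma(1)<\cdots<\sigma(k)$ and $\sigma(k+1)<\cdots<\sigma(n)$. $L_\infty$-algebras. A graded module $L$ with graded anti-symmetric maps $\mu_n:L^{\otimes n}\to L$ of degree $2-n$ ($n\ge1$, $\mu_0=0$) is an $L_\infty$-algebra if for all $n\ge 1$ and homogeneous $a_1,\ldots,a_n\in L$ $$\sum_{k+l=n+1}\ \sum_{\sigma\in \mathrm{Sh}(k,n)}(-1)^{k(l-1)}\chi(\sigma)\,\mu_l(\mu_k(a_{\sigma(1)},\ldots,a_{\sigma(k)}),a_{\sigma(k+1)},\ldots,a_{\sigma(n)})=0.$$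 Trees. $\mathrm{Ot}(n)$ is the set of (equivalence classes of) oriented, i.e. plane, binary trees with $n$ leaves: $\mathrm{Ot}(1)=\{\tau\}$, where $\tau$ has no ramification, and for $n\ge2$ each $\phi\in \mathrm{Ot}(n)$ is uniquely $\phi=\phi_1+\phi_2$ with $\phi_1\in \mathrm{Ot}(i)$, $\phi_2\in \mathrm{Ot}(j)$, $i+j=n$, obtained by attaching $\phi_1$ (left) and $\phi_2$ (right) below a new root. A ramification is an internal vertex (there are $n-1$). Given a family $B=(b_K)$ of bilinear maps $L\otimes L\to L$ indexed by the ramifications, $\phi(B):L^{\otimes n}\to L$ is defined recursively by $\tau(\emptyset)=\mathrm{Id}$ and $\phi(B)=b_{\mathrm{root}}\circ(\phi_1(B_1)\otimes\phi_2(B_2))$, where $B_1,B_2$ are the restrictions of $B$ to the ramifications of $\phi_1,\phi_2$. Ramifications and leaves are totally ordered by depth-first preorder (a ramification precedes its descendants; left descendants precede right ones), and the leaves are numbered $1,\ldots,n$ in this order. For a leaf $i$ let $w_\phi(i)$ be the number of ramifications smaller than $i$ minus $(i-1)$ (equivalently the number of left steps on the path from the root to leaf $i$). For $n\ge 2$ set $e(\phi):=(-1)^{w_\phi(1)+\cdots+w_\phi(n)}$, and $e(\tau):=1$. *)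

theory Defs
  imports Complex_Main "HOL-Library.Tree" "HOL-Combinatorics.Permutations"
begin

section \<open>Graded modules and multilinear maps\<close>

text \<open>The ground ring is a type of sort \<open>comm_ring_1\<close>. That it contains the rational numbers is
  expressed by a ring embedding \<open>\<iota>\<close>.\<close>

definition rat_embedding :: "(rat \<Rightarrow> 'k::comm_ring_1) \<Rightarrow> bool" where
  "rat_embedding \<iota> \<longleftrightarrow> inj \<iota> \<and> \<iota> 1 = 1 \<and>
     (\<forall>x y. \<iota> (x + y) = \<iota> x + \<iota> y) \<and> (\<forall>x y. \<iota> (x * y) = \<iota> x * \<iota> y)"

text \<open>The power of \<open>-1\<close> with an integer exponent, in an arbitrary ring.\<close>

definition msign :: "int \<Rightarrow> 'k::ring_1" where
  "msign p = (if even p then 1 else - 1)"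

text \<open>A submodule \<open>M\<close> that is the internal direct sum of the submodules \<open>G p\<close>.\<close>

locale graded_module = module scale
  for scale :: "'k::comm_ring_1 \<Rightarrow> 'a::ab_group_add \<Rightarrow> 'a" +
  fixes M :: "'a set" and G :: "int \<Rightarrow> 'a set"
  assumes subspace_carrier: "subspace M"
    and subspace_degree: "subspace (G p)"
    and degree_subset: "G p \<subseteq> M"
    and direct_sum: "x \<in> M \<Longrightarrow>
      \<exists>!c. (\<forall>p. c p \<in> G p) \<and> finite {p. c p \<noteq> 0} \<and> x = (\<Sum>p | c p \<noteq> 0. c p)"

definition hcomp :: "(int \<Rightarrow> 'a::ab_group_add set) \<Rightarrow> 'a \<Rightarrow> int \<Rightarrow> 'a" where
  "hcomp G x = (THE c. (\<forall>p. c p \<in> G p) \<and> finite {p. c p \<noteq> 0} \<and> x = (\<Sum>p | c p \<noteq> 0. c p))"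

text \<open>Linear maps on the \<open>n\<close>-th tensor power are represented by \<open>n\<close>-linear maps, which are
  functions of lists of length \<open>n\<close>.

  Formulas with Koszul signs make sense for homogeneous arguments only. They are written as
  functions \<open>F\<close> of the list \<open>ps\<close> of degrees and the list \<open>xs\<close> of homogeneous arguments;
  \<open>multilinear_ext G F\<close> is the extension to all arguments: every argument is split into its
  homogeneous components and \<open>F\<close> is summed over all choices of components.\<close>

definition multilinear_ext ::
  "(int \<Rightarrow> 'a::ab_group_add set) \<Rightarrow> (int list \<Rightarrow> 'a list \<Rightarrow> 'a) \<Rightarrow> 'a list \<Rightarrow> 'a" where
  "multilinear_ext G F xs =
     (\<Sum>ps \<in> listset (map (\<lambda>x. {p. hcomp G x p \<noteq> 0}) xs). F ps (map2 (hcomp G) xs ps))"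

lemma (in graded_module) hcomp_homogeneous:
  assumes "x \<in> G p"
  shows "hcomp G x = (\<lambda>q. if q = p then x else 0)"
proof -
  let ?c = "\<lambda>q. if q = p then x else 0"
  have supp: "{q. ?c q \<noteq> 0} = (if x = 0 then {} else {p})"
    by auto
  have "(\<forall>q. ?c q \<in> G q) \<and> finite {q. ?c q \<noteq> 0} \<and> x = (\<Sum>q | ?c q \<noteq> 0. ?c q)"
    unfolding supp using assms by (auto simp: subspace_0[OF subspace_degree])
  moreover have "x \<in> M" using assms degree_subset by blast
  ultimately show ?thesis
    unfolding hcomp_def by (intro the1_equality direct_sum)
qed

lemma (in graded_module) multilinear_ext_homogeneous:
  assumes "list_all2 (\<lambda>p x. x \<in> G p) ps xs" and "0 \<in> set xs \<Longrightarrow> F ps xs = 0"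
  shows "multilinear_ext G F xs = F ps xs"
proof -
  have "listset (map (\<lambda>x. {p. hcomp G x p \<noteq> 0}) xs) = (if 0 \<in> set xs then {} else {ps})"
    using assms(1)
    by (induction rule: list_all2_induct)
      (auto simp: hcomp_homogeneous set_Cons_def split: if_splits)
  moreover have "map2 (hcomp G) xs ps = xs"
    using assms(1) by (induction rule: list_all2_induct) (auto simp: hcomp_homogeneous)
  ultimately show ?thesis
    using assms(2) by (auto simp: multilinear_ext_def)
qed

definition multilinear_on ::
  "('k \<Rightarrow> 'a::ab_group_add \<Rightarrow> 'a) \<Rightarrow> 'a set \<Rightarrow> nat \<Rightarrow> ('a list \<Rightarrow> 'a) \<Rightarrow> bool" where
  "multilinear_on scale M n f \<longleftrightarrow>
     (\<forall>xs. length xs = n \<and> set xs \<subseteq> M \<longrightarrow> f xs \<in> M) \<and>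
     (\<forall>us vs x y. length us + length vs + 1 = n \<and> set us \<union> set vs \<union> {x, y} \<subseteq> M \<longrightarrow>
        f (us @ (x + y) # vs) = f (us @ x # vs) + f (us @ y # vs)) \<and>
     (\<forall>us vs x c. length us + length vs + 1 = n \<and> set us \<union> set vs \<union> {x} \<subseteq> M \<longrightarrow>
        f (us @ scale c x # vs) = scale c (f (us @ x # vs)))"

definition has_degree ::
  "(int \<Rightarrow> 'a set) \<Rightarrow> nat \<Rightarrow> int \<Rightarrow> ('a list \<Rightarrow> 'a) \<Rightarrow> bool" where
  "has_degree G n r f \<longleftrightarrow>
     (\<forall>ps xs. length ps = n \<and> list_all2 (\<lambda>p x. x \<in> G p) ps xs \<longrightarrow> f xs \<in> G (sum_list ps + r))"

text \<open>Factoring through the exterior power: vanishing on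
  \<open>u \<otimes> (a \<otimes> b + (-1)\<^sup>a\<^sup>b b \<otimes> a) \<otimes> v\<close> for homogeneous \<open>a\<close> and \<open>b\<close>.\<close>

definition graded_antisym ::
  "('k::ring_1 \<Rightarrow> 'a::ab_group_add \<Rightarrow> 'a) \<Rightarrow> 'a set \<Rightarrow> (int \<Rightarrow> 'a set) \<Rightarrow> nat \<Rightarrow>
    ('a list \<Rightarrow> 'a) \<Rightarrow> bool" where
  "graded_antisym scale M G n f \<longleftrightarrow>
     (\<forall>us vs p q a b. length us + length vs + 2 = n \<and> set us \<union> set vs \<subseteq> M \<and> a \<in> G p \<and> b \<in> G q \<longrightarrow>
        f (us @ [a, b] @ vs) + scale (msign (p * q)) (f (us @ [b, a] @ vs)) = 0)"

section \<open>Permutation signs\<close>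

text \<open>Permutations act on the positions \<open>{..<n}\<close>. Since \<open>a \<and> b = -(-1)\<^sup>a\<^sup>b b \<and> a\<close>, the sign
  \<open>\<chi>(\<sigma>)\<close> has one factor \<open>-(-1)\<^sup>a\<^sup>b\<close> for every inversion of \<open>\<sigma>\<close>; \<open>ps\<close> is the list of
  degrees of the arguments.\<close>

definition wedge_sign :: "(nat \<Rightarrow> nat) \<Rightarrow> int list \<Rightarrow> 'k::comm_ring_1" where
  "wedge_sign \<sigma> ps =
     (\<Prod>(i, j) \<in> {(i, j). i < j \<and> j < length ps \<and> \<sigma> j < \<sigma> i}. - msign (ps ! \<sigma> i * ps ! \<sigma> j))"

text \<open>This is the defining property of \<open>\<chi>\<close>.\<close>

lemma (in graded_module) graded_antisym_permute:
  fixes f :: "'a list \<Rightarrow> 'a"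
  assumes antisym: "graded_antisym scale M G n f" and n: "length ps = n"
    and hom: "list_all2 (\<lambda>p x. x \<in> G p) ps xs" and "\<sigma> permutes {..<n}"
  shows "f (permute_list \<sigma> xs) = scale (wedge_sign \<sigma> ps) (f xs)"
  using \<open>\<sigma> permutes {..<n}\<close>
proof (induction "card {(i, j). i < j \<and> j < n \<and> \<sigma> j < \<sigma> i}" arbitrary: \<sigma> rule: less_induct)
  case less
  define I where "I = (\<lambda>\<sigma>::nat \<Rightarrow> nat. {(i, j). i < j \<and> j < n \<and> \<sigma> j < \<sigma> i})"
  have fin: "finite (I \<tau>)" for \<tau>
    by (rule finite_subset[of _ "{..<n} \<times> {..<n}"]) (auto simp: I_def)
  have lx: "length xs = n" using hom n by (simp add: list_all2_lengthD)
  show ?case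
  proof (cases "\<exists>i. Suc i < n \<and> \<sigma> (Suc i) < \<sigma> i")
    case False
    have inj: "inj \<sigma>" using less.prems by (rule permutes_inj)
    have step: "\<sigma> i < \<sigma> (Suc i)" if "Suc i < n" for i
      using False that inj by (metis injD linorder_neqE_nat n_not_Suc_n)
    have ge: "i < n \<Longrightarrow> i \<le> \<sigma> i" for i
    proof (induction i)
      case (Suc i) then show ?case using step[of i] by simp
    qed simp
    have mono: "\<sigma> i < \<sigma> j" if "i < j" "j < n" for i j
      using that
    proof (induction j)
      case (Suc j) then show ?case using step[of j] by (cases "i = j") auto
    qed simp
    have "\<sigma> permutes {..<n}" by (fact less.prems)
    moreover have "I \<sigma> = {}" using mono by (force simp: I_def)
    moreover have "\<sigma> i = i" if "i < n" for i
    proof -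
      have "\<sigma> ` {..<n} = {..<n}" using less.prems by (rule permutes_image)
      have "n - i \<le> n - \<sigma> i"
      proof -
        have "inj_on \<sigma> {i..<n}" using inj by (auto intro: inj_on_subset)
        moreover have "\<sigma> ` {i..<n} \<subseteq> {\<sigma> i..<n}"
        proof (clarsimp)
          fix j assume "i \<le> j" "j < n"
          then show "\<sigma> i \<le> \<sigma> j \<and> \<sigma> j < n"
            using mono[of i j] permutes_in_image[OF less.prems, of j] by (cases "i = j") auto
        qed
        ultimately have "card {i..<n} \<le> card {\<sigma> i..<n}"
          by (intro card_inj_on_le) auto
        then show ?thesis by simp
      qed
      then show ?thesis using ge[OF that] that by linarith
    qed
    ultimately have "\<sigma> = id"
      by (auto simp: fun_eq_iff permutes_def)
    moreover have "wedge_sign id ps = (1 :: 'k)"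
      unfolding wedge_sign_def by (rule prod.neutral) auto
    ultimately show ?thesis by simp
  next
    case True
    then obtain i where i: "Suc i < n" "\<sigma> (Suc i) < \<sigma> i" by blast
    define t where "t = transpose i (Suc i)"
    define \<tau> where "\<tau> = \<sigma> \<circ> t"
    have tp: "t permutes {..<n}" unfolding t_def using i by (intro permutes_swap_id) auto
    have \<tau>: "\<tau> permutes {..<n}" unfolding \<tau>_def using tp less.prems by (rule permutes_compose)
    define h where "h = map_prod t t"
    have "inj t" by (rule permutes_inj[OF tp])
    then have injh: "inj h" by (simp add: h_def prod.inj_map)
    have tt: "t (t j) = j" for j by (simp add: t_def)
    have tlt: "t j < n \<longleftrightarrow> j < n" for j using permutes_in_image[OF tp, of j] by simp
    have tcase: "t j = (if j = i then Suc i else if j = Suc i then i else j)" for j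
      by (simp add: t_def transpose_def)
    have I: "I \<sigma> = insert (i, Suc i) (h ` I \<tau>)" and notin: "(i, Suc i) \<notin> h ` I \<tau>"
    proof -
      have order: "t a < t b \<longleftrightarrow> a < b" if "(a, b) \<noteq> (i, Suc i)" "(a, b) \<noteq> (Suc i, i)" for a b
        using that by (auto simp: tcase)
      have A: "(a, b) \<in> I \<sigma> \<longleftrightarrow> (a, b) = (i, Suc i) \<or> (t a, t b) \<in> I \<tau>" for a b
      proof (cases "(a, b) = (i, Suc i) \<or> (a, b) = (Suc i, i)")
        case True
        then show ?thesis using i by (auto simp: I_def \<tau>_def tcase)
      next
        case False
        then show ?thesis using order[of a b] by (auto simp: I_def \<tau>_def tt tlt)
      qed
      have B: "(a, b) \<in> h ` I \<tau> \<longleftrightarrow> (t a, t b) \<in> I \<tau>" for a b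
        by (force simp: h_def tt image_iff)
      show "I \<sigma> = insert (i, Suc i) (h ` I \<tau>)"
        unfolding set_eq_iff split_paired_All insert_iff A B by simp
      show "(i, Suc i) \<notin> h ` I \<tau>"
        unfolding B by (simp add: I_def tcase)
    qed
    have card: "card (I \<tau>) < card (I \<sigma>)"
      unfolding I using notin fin card_image[OF inj_on_subset[OF injh], of "I \<tau>"] by simp
    have "f (permute_list \<tau> xs) = scale (wedge_sign \<tau> ps) (f xs)"
      using less.hyps[OF _ \<tau>] card by (simp add: I_def)
    moreover have "wedge_sign \<sigma> ps =
      - msign (ps ! \<sigma> i * ps ! \<sigma> (Suc i)) * (wedge_sign \<tau> ps :: 'k)"
    proof -
      have "wedge_sign \<sigma> ps =
          (\<Prod>(i, j) \<in> insert (i, Suc i) (h ` I \<tau>). - msign (ps ! \<sigma> i * ps ! \<sigma> j) :: 'k)"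
        unfolding I[symmetric] by (simp add: wedge_sign_def I_def n)
      also have "\<dots> = - msign (ps ! \<sigma> i * ps ! \<sigma> (Suc i)) *
          (\<Prod>(i, j) \<in> h ` I \<tau>. - msign (ps ! \<sigma> i * ps ! \<sigma> j))"
        using notin fin by simp
      also have "(\<Prod>(i, j) \<in> h ` I \<tau>. - msign (ps ! \<sigma> i * ps ! \<sigma> j) :: 'k) = wedge_sign \<tau> ps"
        unfolding wedge_sign_def n I_def[symmetric]
        by (subst prod.reindex[OF inj_on_subset[OF injh]])
          (auto intro!: prod.cong simp: h_def \<tau>_def I_def)
      finally show ?thesis .
    qed
    moreover have "f (permute_list \<sigma> xs) =
      - scale (msign (ps ! \<sigma> i * ps ! \<sigma> (Suc i))) (f (permute_list \<tau> xs))"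
    proof -
      define us where "us = take i (permute_list \<sigma> xs)"
      define vs where "vs = drop (i + 2) (permute_list \<sigma> xs)"
      have \<sigma>lt: "\<sigma> j < n" if "j < n" for j using permutes_in_image[OF less.prems, of j] that by simp
      have G: "xs ! j \<in> G (ps ! j)" if "j < n" for j
        using hom that n by (simp add: list_all2_conv_all_nth)
      have 1: "permute_list \<sigma> xs = us @ [xs ! \<sigma> i, xs ! \<sigma> (Suc i)] @ vs"
      proof -
        have "permute_list \<sigma> xs = us @ drop i (permute_list \<sigma> xs)" by (simp add: us_def)
        also have "drop i (permute_list \<sigma> xs) = [xs ! \<sigma> i, xs ! \<sigma> (Suc i)] @ vs"
          using i lx by (simp add: vs_def permute_list_def flip: Cons_nth_drop_Suc)
        finally show ?thesis .
      qed
      have S: "Suc (Suc (m - 2)) = m" if "\<not> m \<le> Suc i" for m using that by simp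
      have 2: "permute_list \<tau> xs = us @ [xs ! \<sigma> (Suc i), xs ! \<sigma> i] @ vs"
        by (rule nth_equalityI)
           (use i lx in \<open>auto simp: us_def vs_def permute_list_def \<tau>_def tcase nth_append nth_Cons' S\<close>)
      have "set (permute_list \<sigma> xs) \<subseteq> M"
        using G \<sigma>lt degree_subset lx by (force simp: permute_list_def)
      then have "set us \<union> set vs \<subseteq> M"
        using set_take_subset set_drop_subset by (fastforce simp: us_def vs_def)
      moreover have "length us + length vs + 2 = n" using i lx by (simp add: us_def vs_def)
      ultimately have "f (permute_list \<sigma> xs) +
          scale (msign (ps ! \<sigma> i * ps ! \<sigma> (Suc i))) (f (permute_list \<tau> xs)) = 0"
        using antisym G[OF \<sigma>lt] i unfolding graded_antisym_def 1 2 by auto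
      then show ?thesis by (simp add: eq_neg_iff_add_eq_0)
    qed
    ultimately show ?thesis by simp
  qed
qed

definition Sh :: "nat \<Rightarrow> nat \<Rightarrow> (nat \<Rightarrow> nat) set" where
  "Sh k n = {\<sigma>. \<sigma> permutes {..<n} \<and> strict_mono_on {..<k} \<sigma> \<and> strict_mono_on {k..<n} \<sigma>}"

text \<open>Precomposition with the anti-symmetrization map \<open>\<alpha>\<^sub>n\<close>.\<close>

definition antisymmetrize ::
  "('k::comm_ring_1 \<Rightarrow> 'a::ab_group_add \<Rightarrow> 'a) \<Rightarrow> (int list \<Rightarrow> 'a list \<Rightarrow> 'a) \<Rightarrow>
    int list \<Rightarrow> 'a list \<Rightarrow> 'a" where
  "antisymmetrize scale F ps xs =
     (\<Sum>\<sigma> | \<sigma> permutes {..<length xs}.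
        scale (wedge_sign \<sigma> ps) (F (permute_list \<sigma> ps) (permute_list \<sigma> xs)))"

section \<open>L-infinity algebras\<close>

locale L_infinity_algebra = graded_module scale M G
  for scale :: "'k::comm_ring_1 \<Rightarrow> 'a::ab_group_add \<Rightarrow> 'a"
    and M :: "'a set" and G :: "int \<Rightarrow> 'a set" +
  fixes \<mu> :: "nat \<Rightarrow> 'a list \<Rightarrow> 'a"
  assumes mu_0: "\<mu> 0 xs = 0"
    and multilinear: "n \<ge> 1 \<Longrightarrow> multilinear_on scale M n (\<mu> n)"
    and degree: "n \<ge> 1 \<Longrightarrow> has_degree G n (2 - int n) (\<mu> n)"
    and antisym: "n \<ge> 1 \<Longrightarrow> graded_antisym scale M G n (\<mu> n)"
    and relation: "\<lbrakk>n \<ge> 1; length ps = n; list_all2 (\<lambda>p a. a \<in> G p) ps as\<rbrakk> \<Longrightarrow>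
      (\<Sum>(k, l) \<in> {(k, l). k \<ge> 1 \<and> l \<ge> 1 \<and> k + l = n + 1}. \<Sum>\<sigma> \<in> Sh k n.
         scale ((- 1) ^ (k * (l - 1)) * wedge_sign \<sigma> ps)
           (\<mu> l (\<mu> k (take k (permute_list \<sigma> as)) # drop k (permute_list \<sigma> as)))) = 0"

section \<open>Differential graded Lie algebras\<close>

locale dg_lie_algebra = graded_module scale UNIV G
  for scale :: "'k::comm_ring_1 \<Rightarrow> 'a::ab_group_add \<Rightarrow> 'a" and G :: "int \<Rightarrow> 'a set" +
  fixes d :: "'a \<Rightarrow> 'a" and br :: "'a \<Rightarrow> 'a \<Rightarrow> 'a"
  assumes d_linear: "module_hom scale scale d"
    and d_degree: "x \<in> G p \<Longrightarrow> d x \<in> G (p + 1)"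
    and d_d: "d (d x) = 0"
    and br_linear_left: "module_hom scale scale (\<lambda>x. br x y)"
    and br_linear_right: "module_hom scale scale (br x)"
    and br_degree: "\<lbrakk>x \<in> G p; y \<in> G q\<rbrakk> \<Longrightarrow> br x y \<in> G (p + q)"
    and br_antisym: "\<lbrakk>x \<in> G p; y \<in> G q\<rbrakk> \<Longrightarrow> br x y = - scale (msign (p * q)) (br y x)"
    and jacobi: "\<lbrakk>x \<in> G p; y \<in> G q; z \<in> G r\<rbrakk> \<Longrightarrow>
      br x (br y z) = br (br x y) z + scale (msign (p * q)) (br y (br x z))"
    and leibniz: "\<lbrakk>x \<in> G p; y \<in> G q\<rbrakk> \<Longrightarrow>
      d (br x y) = br (d x) y + scale (msign p) (br x (d y))"

definition cohomologous :: "('a::ab_group_add \<Rightarrow> 'a) \<Rightarrow> ('a \<times> 'a) set" where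
  "cohomologous d = {(x, y). d x = 0 \<and> d y = 0 \<and> x - y \<in> range d}"

definition cohomology :: "('a::ab_group_add \<Rightarrow> 'a) \<Rightarrow> 'a set set" where
  "cohomology d = {x. d x = 0} // cohomologous d"

section \<open>Plane binary trees\<close>

text \<open>The ramifications of a plane binary tree are the inner nodes of a library tree, so the
  unlabelled trees are those of type \<open>unit tree\<close>, and a tree together with a family indexed by
  its ramifications is a labelled tree.\<close>

definition Ot :: "nat \<Rightarrow> unit tree set" where
  "Ot n = {\<phi>. size1 \<phi> = n}"

lemma finite_Ot: "finite (Ot n)"
proof (induction n rule: less_induct)
  case (less n)
  have "Ot n \<subseteq> {Leaf} \<union> (\<lambda>(l, r). Node l () r) ` ((\<Union>m<n. Ot m) \<times> (\<Union>m<n. Ot m))"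
  proof
    fix t assume "t \<in> Ot n"
    then show "t \<in> {Leaf} \<union> (\<lambda>(l, r). Node l () r) ` ((\<Union>m<n. Ot m) \<times> (\<Union>m<n. Ot m))"
      using size1_ge0 by (cases t) (force simp: Ot_def image_iff Suc_le_eq)+
  qed
  moreover have "finite \<dots>"
    using less by auto
  ultimately show ?case
    by (rule finite_subset)
qed

text \<open>For each leaf, in preorder, the number of ramifications that are smaller.\<close>

fun smaller_ramifications :: "'b tree \<Rightarrow> nat list" where
  "smaller_ramifications Leaf = [0]"
| "smaller_ramifications (Node l _ r) =
     map (\<lambda>k. 1 + k) (smaller_ramifications l) @ map (\<lambda>k. 1 + size l + k) (smaller_ramifications r)"

text \<open>Leaves are counted from \<open>0\<close>, hence \<open>i\<close> in place of \<open>i - 1\<close>.\<close>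

definition leaf_weight :: "'b tree \<Rightarrow> nat \<Rightarrow> int" where
  "leaf_weight \<phi> i = int (smaller_ramifications \<phi> ! i) - int i"

definition tree_sign :: "'b tree \<Rightarrow> 'k::ring_1" where
  "tree_sign \<phi> = (if \<phi> = Leaf then 1 else msign (\<Sum>i < size1 \<phi>. leaf_weight \<phi> i))"

text \<open>A label \<open>(r, b)\<close> stands for a bilinear map \<open>b\<close> of degree \<open>r\<close>. As all maps have been given
  their degree, the degree of \<open>\<phi>(B)\<close> is the sum of the degrees of the labels.\<close>

type_synonym 'a graded_bilinear = "int \<times> ('a \<Rightarrow> 'a \<Rightarrow> 'a)"

definition tree_degree :: "'a graded_bilinear tree \<Rightarrow> int" where
  "tree_degree B = sum_list (map fst (preorder B))"

text \<open>The map \<open>\<phi>(B)\<close> on homogeneous arguments \<open>xs\<close> of degrees \<open>ps\<close>. The sign is the Koszul sign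
  of \<open>\<phi>\<^sub>1(B\<^sub>1) \<otimes> \<phi>\<^sub>2(B\<^sub>2)\<close>.\<close>

fun tree_map ::
  "('k::ring_1 \<Rightarrow> 'a \<Rightarrow> 'a) \<Rightarrow> 'a graded_bilinear tree \<Rightarrow> int list \<Rightarrow> 'a list \<Rightarrow> 'a" where
  "tree_map scale Leaf ps xs = hd xs"
| "tree_map scale (Node B1 (_, b) B2) ps xs =
     (let m = size1 B1 in
      scale (msign (tree_degree B2 * sum_list (take m ps)))
        (b (tree_map scale B1 (take m ps) (take m xs)) (tree_map scale B2 (drop m ps) (drop m xs))))"

text \<open>The family with \<open>b\<close> at the root and \<open>g\<close> at all other ramifications.\<close>

fun root_label :: "'b \<Rightarrow> 'b \<Rightarrow> unit tree \<Rightarrow> 'b tree" where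
  "root_label b g Leaf = Leaf"
| "root_label b g (Node l _ r) = Node (Tree.map_tree (\<lambda>_. g) l) b (Tree.map_tree (\<lambda>_. g) r)"

section \<open>The transferred structure\<close>

definition comm_d_eta :: "('a::ab_group_add \<Rightarrow> 'a) \<Rightarrow> ('a \<Rightarrow> 'a) \<Rightarrow> 'a \<Rightarrow> 'a" where
  "comm_d_eta d \<eta> x = d (\<eta> x) + \<eta> (d x)"

definition harmonic :: "('a::ab_group_add \<Rightarrow> 'a) \<Rightarrow> ('a \<Rightarrow> 'a) \<Rightarrow> 'a set" where
  "harmonic d \<eta> = {x. x - comm_d_eta d \<eta> x = x}"

text \<open>For \<open>n = 2\<close> the general formula is used here; on \<open>harmonic d \<eta>\<close> it agrees with
  \<open>(1 - d\<eta>)[\<cdot>,\<cdot>]\<close>.\<close>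

definition transferred ::
  "(rat \<Rightarrow> 'k::comm_ring_1) \<Rightarrow> ('k \<Rightarrow> 'a::ab_group_add \<Rightarrow> 'a) \<Rightarrow> (int \<Rightarrow> 'a set) \<Rightarrow>
    ('a \<Rightarrow> 'a) \<Rightarrow> ('a \<Rightarrow> 'a) \<Rightarrow> ('a \<Rightarrow> 'a \<Rightarrow> 'a) \<Rightarrow> nat \<Rightarrow> 'a list \<Rightarrow> 'a" where
  "transferred \<iota> scale G d \<eta> br n =
     (if n \<ge> 2 then
        multilinear_ext G (\<lambda>ps xs.
          scale (\<iota> ((- 1 / 2) ^ (n - 1)))
            (\<Sum>\<phi> \<in> Ot n. scale (tree_sign \<phi>)
              (antisymmetrize scale
                (tree_map scale
                  (root_label (0, \<lambda>x y. br x y - comm_d_eta d \<eta> (br x y)) (-1, \<lambda>x y. \<eta> (br x y)) \<phi>))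
                ps xs)))
      else (\<lambda>_. 0))"

end

theory Submission
  imports Defs
begin

text \<open>
  Cutting trees at the root turns the tree formula into a fixed point equation, from which the
  L-infinity relations follow by a short computation with the curvature of the solution.

  Let \<open>\<Phi>\<close> be the family of antisymmetrized tree sums with \<open>g\<close> at every ramification and coefficient
  \<open>(- 1 / 2) ^ (n - 1)\<close>. A tree is a pair of trees below a root, so
  \<open>\<Phi> = inclusion - \<onehalf> \<eta>[\<Phi>,\<Phi>]\<close> (\<open>Phi_rec\<close>), where \<open>[\<Phi>,\<Phi>]\<close> is a signed sum over all ways to distribute
  the arguments over the two sides of the bracket. Likewise the transferred brackets are
  \<open>\<mu> = - \<onehalf> p[\<Phi>,\<Phi>]\<close> with \<open>p = 1 - [d,\<eta>]\<close> (\<open>transferred_summand_eq_mu\<close>). In terms of generating functions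
  \<open>\<Phi>\<close> is an element of degree one in a differential graded Lie algebra, and its bracket with itself
  is symmetric.

  Consider the curvature \<open>R = - (d\<Phi> + \<onehalf>[\<Phi>,\<Phi>])\<close>. The Leibniz rule \<open>d[\<Phi>,\<Phi>] = 2[d\<Phi>,\<Phi>]\<close> (\<open>d_Br\<close>) and the
  Jacobi identity \<open>[[\<Phi>,\<Phi>],\<Phi>] = 0\<close> (\<open>left_br_Br\<close>) give \<open>[R,\<Phi>] = - \<onehalf> d[\<Phi>,\<Phi>]\<close>. On harmonic arguments the
  fixed point equation and \<open>1 - d \<eta> = p + \<eta> d\<close> therefore yield \<open>R = \<mu> + \<eta>[R,\<Phi>]\<close> (\<open>curvature_rec\<close>).

  The derivative \<open>\<Psi>\<close> of \<open>\<Phi>\<close> in the direction of \<open>\<mu>\<close>, obtained by inserting values of \<open>\<mu>\<close> as arguments of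
  \<open>\<Phi>\<close>, satisfies the same equation \<open>\<Psi> = \<mu> + \<eta>[\<Psi>,\<Phi>]\<close> (\<open>Phi_along_mu_rec\<close>): differentiate the fixed point
  equation, using that the unshuffle coproduct is coassociative and cocommutative. This equation
  determines its solution by induction on the number of arguments, hence \<open>\<Psi> = R\<close>.

  The L-infinity relation says that the derivative of \<open>\<mu>\<close> in the direction of \<open>\<mu>\<close> vanishes. That
  derivative is \<open>p[\<Psi>,\<Phi>] = p[R,\<Phi>] = - \<onehalf> p d[\<Phi>,\<Phi>]\<close>, which is \<open>0\<close> as \<open>p d = 0\<close> (\<open>mu_relation\<close>).

  All functions are evaluated on lists of pairs of a degree and an element. Sums over permutations,
  shuffles and unshuffles are defined by recursion on such lists and are then identified with the sums
  over sets of permutations in the definitions. The exponents of the signs in the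
  computation with \<open>\<Phi>\<close> depend on the lengths and the total degrees of the lists involved only.
\<close>

section \<open>Signed sums over unshuffles, splittings and permutations\<close>

text \<open>Signs are carried by integer exponents, of which only the parity matters. Comparing two
  signs thereby amounts to comparing the parities of two integers.\<close>

definition signed :: "int \<Rightarrow> 'a::ab_group_add \<Rightarrow> 'a" where
  "signed k v = (if even k then v else - v)"

lemma signed_cong: "even k = even m \<Longrightarrow> signed k v = signed m v"
  by (simp add: signed_def)

lemma signed_0 [simp]: "signed k 0 = 0" "signed 0 v = v"
  by (simp_all add: signed_def)

lemma signed_add: "signed k (v + w) = signed k v + signed k w"
  by (simp add: signed_def)

lemma signed_minus: "signed k (- v) = - signed k v"
  by (simp add: signed_def)

lemma signed_signed: "signed k (signed m v) = signed (k + m) v"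
  by (auto simp: signed_def)

lemma signed_sum: "signed k (\<Sum>x\<in>A. f x) = (\<Sum>x\<in>A. signed k (f x))"
  by (simp add: signed_def sum_negf)

lemma signed_Suc: "signed (k + 1) v = - signed k v" "signed (1 + k) v = - signed k v"
  by (auto simp: signed_def)

abbreviation len :: "'b list \<Rightarrow> int" where "len l \<equiv> int (length l)"

definition deg :: "(int \<times> 'b) list \<Rightarrow> int" where
  "deg l = sum_list (map fst l)"

lemma deg_simps [simp]: "deg [] = 0" "deg (x # l) = fst x + deg l" "deg (l @ m) = deg l + deg m"
  by (simp_all add: deg_def)

text \<open>The entries of a list, which are pairs of a degree and an element, are distributed in all ways
  over two subsequences \<open>A\<close> and \<open>B\<close>. This is the coproduct of the graded exterior coalgebra,
  followed by \<open>h\<close>; the sign is the one of moving an entry of \<open>B\<close> to the right past the entries of \<open>A\<close>,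
  which depends on \<open>A\<close> through its length and its total degree only.\<close>

fun unshuffle_sum :: "((int \<times> 'b) list \<Rightarrow> (int \<times> 'b) list \<Rightarrow> 'a::ab_group_add) \<Rightarrow> (int \<times> 'b) list \<Rightarrow> 'a" where
  "unshuffle_sum h [] = h [] []"
| "unshuffle_sum h (x # l) = unshuffle_sum (\<lambda>A B. h (x # A) B) l +
     unshuffle_sum (\<lambda>A B. signed (len A + fst x * deg A) (h A (x # B))) l"

text \<open>The parts \<open>A\<close> and \<open>B\<close> partition the multiset of entries. The next lemma reads off from this how
  lengths and degrees distribute over the parts.\<close>

lemma unshuffle_sum_cong:
  "(\<And>A B. mset A + mset B = mset l \<Longrightarrow> h A B = h' A B) \<Longrightarrow> unshuffle_sum h l = unshuffle_sum h' l"
proof (induction l arbitrary: h h')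
  case (Cons x l)
  show ?case
    by (simp, intro arg_cong2[of _ _ _ _ "(+)"] Cons.IH) (simp_all add: Cons.prems)
qed simp

lemma unshuffle_parts:
  assumes "mset A + mset B = mset l"
  shows "len l = len A + len B" "deg l = deg A + deg B" "set l = set A \<union> set B"
    "length l = length A + length B"
proof -
  have m: "mset l = mset (A @ B)" using assms by simp
  show l: "length l = length A + length B" by (metis m mset_eq_length length_append)
  then show "len l = len A + len B" by simp
  show "set l = set A \<union> set B" by (metis m mset_eq_setD set_append)
  have "sum_mset (image_mset fst (mset l)) = sum_mset (image_mset fst (mset (A @ B)))"
    by (simp only: m)
  then show "deg l = deg A + deg B" unfolding deg_def
    by (simp only: mset_map[symmetric] sum_mset_sum_list) simp
qed

lemma unshuffle_sum_add:
  "unshuffle_sum (\<lambda>A B. h A B + h' A B) l = unshuffle_sum h l + unshuffle_sum h' l"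
  by (induction l arbitrary: h h') (simp_all add: signed_add)

lemma unshuffle_sum_additive:
  assumes "\<And>v w. f (v + w) = f v + f w"
  shows "f (unshuffle_sum h l) = unshuffle_sum (\<lambda>A B. f (h A B)) l"
proof (induction l arbitrary: h)
  case (Cons x l)
  interpret additive f by standard (rule assms)
  have "f (signed k v) = signed k (f v)" for k v by (simp add: signed_def minus)
  then show ?case by (simp add: Cons assms)
qed simp

lemmas signed_unshuffle_sum = unshuffle_sum_additive[of "signed k" for k, OF signed_add]
lemmas minus_unshuffle_sum = unshuffle_sum_additive[of uminus, OF minus_add_distrib]

lemma unshuffle_sum_zero [simp]: "unshuffle_sum (\<lambda>A B. 0) l = 0"
  by (induction l) simp_all

text \<open>Both sides distribute the entries over three subsequences. The signs agree because passing a list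
  costs the product of the signs of passing its two parts.\<close>

lemma unshuffle_sum_coassoc:
  "unshuffle_sum (\<lambda>A C. unshuffle_sum (\<lambda>A1 A2. h A1 A2 C) A) l =
   unshuffle_sum (\<lambda>A C. unshuffle_sum (\<lambda>C1 C2. h A C1 C2) C) l"
proof (induction l arbitrary: h)
  case (Cons x l)
  have *: "unshuffle_sum (\<lambda>A C. signed (len A + fst x * deg A) (unshuffle_sum (\<lambda>A1 A2. h A1 A2 (x # C)) A)) l
    = unshuffle_sum (\<lambda>A C. unshuffle_sum (\<lambda>A1 A2. signed (len A1 + fst x * deg A1)
          (signed (len A2 + fst x * deg A2) (h A1 A2 (x # C)))) A) l"
    unfolding signed_unshuffle_sum
    by (intro unshuffle_sum_cong)
      (auto simp: signed_signed unshuffle_parts algebra_simps)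
  show ?case
    by (simp only: unshuffle_sum.simps unshuffle_sum_add *)
      (simp add: unshuffle_sum_add signed_unshuffle_sum Cons signed_add add.assoc)
qed simp

text \<open>Interchanging the roles of \<open>A\<close> and \<open>B\<close> moves every entry of one past every entry of the other.\<close>

lemma unshuffle_sum_cocomm:
  "unshuffle_sum h l = unshuffle_sum (\<lambda>A B. signed (len A * len B + deg A * deg B) (h B A)) l"
proof (induction l arbitrary: h)
  case (Cons x l)
  have "unshuffle_sum h (x # l) =
     unshuffle_sum (\<lambda>A B. signed (len A * len B + deg A * deg B) (h (x # B) A)) l +
     unshuffle_sum (\<lambda>A B. signed (len A * len B + deg A * deg B)
       (signed (len B + fst x * deg B) (h B (x # A)))) l"
    by (simp add: Cons[of "\<lambda>A B. h (x # A) B"] Cons[of "\<lambda>A B. signed (len A + fst x * deg A) (h A (x # B))"])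
  also have "\<dots> = unshuffle_sum (\<lambda>A B. signed (len A * len B + deg A * deg B) (h B A)) (x # l)"
    unfolding unshuffle_sum.simps signed_signed
    by (subst add.commute, intro arg_cong2[of _ _ _ _ "(+)"] unshuffle_sum_cong signed_cong)
      (auto)
  finally show ?case .
qed simp

lemma unshuffle_sum_right_empty: "unshuffle_sum (\<lambda>A B. if B = [] then h A else 0) l = h l"
  by (induction l arbitrary: h) simp_all

text \<open>Cutting a list into two consecutive parts is what cutting a plane tree at its root does to its
  list of leaves.\<close>

fun split_sum :: "('b list \<Rightarrow> 'b list \<Rightarrow> 'a::ab_group_add) \<Rightarrow> 'b list \<Rightarrow> 'a" where
  "split_sum h [] = h [] []"
| "split_sum h (x # l) = h [] (x # l) + split_sum (\<lambda>A B. h (x # A) B) l"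

lemma split_sum_take_drop: "split_sum h l = (\<Sum>k\<le>length l. h (take k l) (drop k l))"
  by (induction l arbitrary: h) (simp_all add: sum.atMost_Suc_shift del: sum.atMost_Suc)

lemma split_sum_add: "split_sum (\<lambda>A B. h A B + h' A B) l = split_sum h l + split_sum h' l"
  by (simp add: split_sum_take_drop sum.distrib)

lemma split_sum_signed: "split_sum (\<lambda>A B. signed k (h A B)) l = signed k (split_sum h l)"
  by (simp add: split_sum_take_drop signed_sum)

text \<open>Antisymmetrization is built up by inserting the entries one at a time at all positions. In this
  form it is accessible to induction on lists, without any reference to permutations of positions.\<close>

fun insert_sum :: "int \<times> 'b \<Rightarrow> ((int \<times> 'b) list \<Rightarrow> 'a::ab_group_add) \<Rightarrow> (int \<times> 'b) list \<Rightarrow> 'a" where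
  "insert_sum x f [] = f [x]"
| "insert_sum x f (y # l) = f (x # y # l) + signed (1 + fst x * fst y) (insert_sum x (\<lambda>l. f (y # l)) l)"

fun perm_sum :: "((int \<times> 'b) list \<Rightarrow> 'a::ab_group_add) \<Rightarrow> (int \<times> 'b) list \<Rightarrow> 'a" where
  "perm_sum f [] = f []"
| "perm_sum f (x # l) = perm_sum (insert_sum x f) l"

lemma insert_sum_add: "insert_sum x (\<lambda>l. f l + g l) l = insert_sum x f l + insert_sum x g l"
  by (induction l arbitrary: f g) (simp_all add: signed_add)

lemma insert_sum_take_drop:
  "insert_sum x f l = (\<Sum>k\<le>length l. signed (int k + fst x * deg (take k l)) (f (take k l @ x # drop k l)))"
  by (induction l arbitrary: f)
    (simp_all add: sum.atMost_Suc_shift signed_sum signed_signed algebra_simps del: sum.atMost_Suc)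

lemma insert_sum_additive:
  assumes "\<And>v w. f (v + w) = f v + f w"
  shows "f (insert_sum x g l) = insert_sum x (\<lambda>l. f (g l)) l"
proof -
  interpret additive f by standard (rule assms)
  have "f (signed k v) = signed k (f v)" for k v by (simp add: signed_def minus)
  then show ?thesis by (simp add: insert_sum_take_drop sum)
qed

lemma perm_sum_add: "perm_sum (\<lambda>l. f l + g l) l = perm_sum f l + perm_sum g l"
  by (induction l arbitrary: f g) (simp_all add: insert_sum_add[abs_def])

lemma perm_sum_additive:
  assumes "\<And>v w. f (v + w) = f v + f w"
  shows "f (perm_sum g l) = perm_sum (\<lambda>l. f (g l)) l"
  by (induction l arbitrary: g) (simp_all add: insert_sum_additive[OF assms])

text \<open>A cut of a list containing \<open>x\<close> has \<open>x\<close> in its left part, or in its right part after passing the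
  whole left part.\<close>

lemma insert_sum_split_sum:
  "insert_sum x (split_sum h) l =
   split_sum (\<lambda>A B. insert_sum x (\<lambda>A. h A B) A + signed (len A + fst x * deg A) (insert_sum x (h A) B)) l"
proof (induction l arbitrary: h)
  case (Cons y l)
  show ?case
    by (simp add: insert_sum_add Cons split_sum_add signed_add flip: split_sum_signed)
      (simp add: signed_signed algebra_simps)
qed simp

lemma insert_sum_zero [simp]: "insert_sum x (\<lambda>l. 0) = (\<lambda>l. 0)"
  by (simp add: insert_sum_take_drop fun_eq_iff)

lemma perm_sum_zero [simp]: "perm_sum (\<lambda>l. 0) l = 0"
  by (induction l) simp_all

lemma perm_sum_signed: "perm_sum (\<lambda>l. signed k (f l)) l = signed k (perm_sum f l)"
  by (rule perm_sum_additive[symmetric]) (rule signed_add)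

lemma perm_sum_insert_sum:
  "perm_sum (\<lambda>B. insert_sum x (\<lambda>A. h A B) A) B = insert_sum x (\<lambda>A. perm_sum (h A) B) A"
  by (induction A arbitrary: h) (simp_all add: perm_sum_add perm_sum_signed)

lemma insert_sum_cong:
  "(\<And>m. mset m = add_mset x (mset l) \<Longrightarrow> f m = g m) \<Longrightarrow> insert_sum x f l = insert_sum x g l"
proof (induction l arbitrary: f g)
  case (Cons y l)
  have "insert_sum x (\<lambda>l. f (y # l)) l = insert_sum x (\<lambda>l. g (y # l)) l"
    by (rule Cons.IH) (simp add: Cons.prems)
  then show ?case by (simp add: Cons.prems)
qed simp

lemma perm_sum_cong:
  "(\<And>m. mset m = mset l \<Longrightarrow> f m = g m) \<Longrightarrow> perm_sum f l = perm_sum g l"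
proof (induction l arbitrary: f g)
  case (Cons x l)
  have "perm_sum (insert_sum x f) l = perm_sum (insert_sum x g) l"
    by (intro Cons.IH insert_sum_cong Cons.prems) simp
  then show ?case by simp
qed simp

text \<open>An ordering of \<open>l\<close> that is cut into two consecutive parts is the same as an unshuffle of \<open>l\<close>
  together with an ordering of each part. This turns the recursion for plane trees into one for
  antisymmetrized sums, in which only unshuffles occur.\<close>

lemma perm_sum_split_sum:
  fixes h :: "(int \<times> 'b) list \<Rightarrow> (int \<times> 'b) list \<Rightarrow> 'a::ab_group_add"
  shows "perm_sum (split_sum h) l = unshuffle_sum (\<lambda>A B. perm_sum (\<lambda>A. perm_sum (h A) B) A) l"
proof (induction l arbitrary: h)
  case (Cons x l)
  have *: "perm_sum (\<lambda>A'. signed (len A' + fst x * deg A') (f A')) A =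
      signed (len A + fst x * deg A) (perm_sum f A)" for f :: "(int \<times> 'b) list \<Rightarrow> 'a" and A
    unfolding perm_sum_signed[symmetric]
  proof (rule perm_sum_cong)
    fix m assume "mset m = mset A"
    then show "signed (len m + fst x * deg m) (f m) = signed (len A + fst x * deg A) (f m)"
      using unshuffle_parts(1,2)[of m "[]" A] by simp
  qed
  have "perm_sum (split_sum h) (x # l) = perm_sum (insert_sum x (split_sum h)) l" by simp
  also have "insert_sum x (split_sum h) = split_sum (\<lambda>A B. insert_sum x (\<lambda>A. h A B) A +
      signed (len A + fst x * deg A) (insert_sum x (h A) B))"
    by (rule ext) (rule insert_sum_split_sum)
  also have "perm_sum \<dots> l = unshuffle_sum (\<lambda>A B. perm_sum (\<lambda>A. perm_sum (h A) B) A) (x # l)"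
    by (simp add: Cons perm_sum_add perm_sum_insert_sum perm_sum_signed * unshuffle_sum_add)
  finally show ?case .
qed simp

text \<open>The summands with \<open>a\<close> and \<open>b\<close> in different parts cancel in pairs; in the others, \<open>h\<close> is
  antisymmetric. The hypotheses are restricted to lists of total length \<open>n\<close>, so that the lemma can be
  applied to functions that are themselves defined by recursion over unshuffles.\<close>

lemma unshuffle_sum_antisym:
  assumes "\<And>us vs B. length us + length vs + length B + 2 = n \<Longrightarrow>
      h (us @ [a, b] @ vs) B + signed (fst a * fst b) (h (us @ [b, a] @ vs) B) = 0"
    and "\<And>us vs A. length us + length vs + length A + 2 = n \<Longrightarrow>
      h A (us @ [a, b] @ vs) + signed (fst a * fst b) (h A (us @ [b, a] @ vs)) = 0"
    and "length us + length vs + 2 = n"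
  shows "unshuffle_sum h (us @ [a, b] @ vs) + signed (fst a * fst b) (unshuffle_sum h (us @ [b, a] @ vs)) = 0"
  using assms
proof (induction us arbitrary: h n)
  case Nil
  have 1: "h (a # b # A) B + signed (fst a * fst b) (h (b # a # A) B) = 0"
    "h A (a # b # B) + signed (fst a * fst b) (h A (b # a # B)) = 0"
    if "length A + length B + 2 = n" for A B
    using Nil(1)[of "[]" A B] Nil(2)[of "[]" B A] that by (simp_all add: add.commute)
  have "unshuffle_sum h ([a, b] @ vs) + signed (fst a * fst b) (unshuffle_sum h ([b, a] @ vs)) =
    unshuffle_sum (\<lambda>A B. h (a # b # A) B + signed (fst a * fst b) (h (b # a # A) B) +
      signed (len A + fst b * deg A + len A + fst a * deg A)
       (h A (a # b # B) + signed (fst a * fst b) (h A (b # a # B)))) vs"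
    by (simp add: signed_unshuffle_sum signed_add signed_signed flip: unshuffle_sum_add)
      (rule unshuffle_sum_cong, rename_tac A B, case_tac "even (fst a)"; case_tac "even (fst b)";
        case_tac "even (len A)"; case_tac "even (deg A)"; simp add: signed_def)
  also have "\<dots> = unshuffle_sum (\<lambda>A B. 0) vs"
    by (rule unshuffle_sum_cong) (use Nil(3) in \<open>auto simp: 1 dest!: unshuffle_parts(4)\<close>)
  finally show ?case by simp
next
  case (Cons x us)
  have 1: "unshuffle_sum (\<lambda>A B. h (x # A) B) (us @ [a, b] @ vs) +
      signed (fst a * fst b) (unshuffle_sum (\<lambda>A B. h (x # A) B) (us @ [b, a] @ vs)) = 0"
    by (rule Cons.IH[of "n - 1"]) (use Cons.prems(1)[of "x # _"] Cons.prems(2)[of _ _ "x # _"] Cons.prems(3) in simp_all)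
  have "unshuffle_sum (\<lambda>A B. signed (len A + fst x * deg A) (h A (x # B))) (us @ [a, b] @ vs) +
      signed (fst a * fst b) (unshuffle_sum (\<lambda>A B. signed (len A + fst x * deg A) (h A (x # B))) (us @ [b, a] @ vs)) = 0"
  proof (rule Cons.IH[of "n - 1"])
    fix us vs B :: "(int \<times> 'a) list" assume "length us + length vs + length B + 2 = n - 1"
    then have "h (us @ [a, b] @ vs) (x # B) + signed (fst a * fst b) (h (us @ [b, a] @ vs) (x # B)) = 0"
      by (intro Cons.prems(1)) simp
    then have "signed (len (us @ [a, b] @ vs) + fst x * deg (us @ [a, b] @ vs))
      (h (us @ [a, b] @ vs) (x # B) + signed (fst a * fst b) (h (us @ [b, a] @ vs) (x # B))) = 0"
      by simp
    then show "signed (len (us @ [a, b] @ vs) + fst x * deg (us @ [a, b] @ vs)) (h (us @ [a, b] @ vs) (x # B)) +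
      signed (fst a * fst b) (signed (len (us @ [b, a] @ vs) + fst x * deg (us @ [b, a] @ vs)) (h (us @ [b, a] @ vs) (x # B))) = 0"
      by (simp add: signed_add signed_signed algebra_simps)
  next
    fix us vs A :: "(int \<times> 'a) list" assume "length us + length vs + length A + 2 = n - 1"
    then have "h A (x # us @ [a, b] @ vs) + signed (fst a * fst b) (h A (x # us @ [b, a] @ vs)) = 0"
      using Cons.prems(2)[of "x # us" vs A] by simp
    then have "signed (len A + fst x * deg A)
      (h A (x # us @ [a, b] @ vs) + signed (fst a * fst b) (h A (x # us @ [b, a] @ vs))) = 0"
      by simp
    then show "signed (len A + fst x * deg A) (h A (x # us @ [a, b] @ vs)) +
      signed (fst a * fst b) (signed (len A + fst x * deg A) (h A (x # us @ [b, a] @ vs))) = 0"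
      by (simp add: signed_add signed_signed add.commute)
  qed (use Cons.prems(3) in simp)
  with 1 have "(unshuffle_sum (\<lambda>A B. h (x # A) B) (us @ [a, b] @ vs) +
      signed (fst a * fst b) (unshuffle_sum (\<lambda>A B. h (x # A) B) (us @ [b, a] @ vs))) +
    (unshuffle_sum (\<lambda>A B. signed (len A + fst x * deg A) (h A (x # B))) (us @ [a, b] @ vs) +
      signed (fst a * fst b) (unshuffle_sum (\<lambda>A B. signed (len A + fst x * deg A) (h A (x # B))) (us @ [b, a] @ vs))) = 0"
    by simp
  then show ?case by (simp only: append_Cons unshuffle_sum.simps signed_add ac_simps)
qed

context module
begin

lemma signed_scale: "signed k (scale c v) = scale c (signed k v)"
  by (simp add: signed_def)

lemma scale_msign: "scale (msign k) v = signed k v"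
  by (simp add: signed_def msign_def)

lemma unshuffle_sum_linear:
  assumes "\<And>us vs B. length us + length vs + length B + 1 = n \<Longrightarrow>
      h (us @ (p, scale c v + w) # vs) B = scale c (h (us @ (p, v) # vs) B) + h (us @ (p, w) # vs) B"
    and "\<And>us vs A. length us + length vs + length A + 1 = n \<Longrightarrow>
      h A (us @ (p, scale c v + w) # vs) = scale c (h A (us @ (p, v) # vs)) + h A (us @ (p, w) # vs)"
    and "length us + length vs + 1 = n"
  shows "unshuffle_sum h (us @ (p, scale c v + w) # vs) =
    scale c (unshuffle_sum h (us @ (p, v) # vs)) + unshuffle_sum h (us @ (p, w) # vs)"
  using assms
proof (induction us arbitrary: h n)
  case Nil
  have 1: "h ((p, scale c v + w) # A) B = scale c (h ((p, v) # A) B) + h ((p, w) # A) B"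
    "h A ((p, scale c v + w) # B) = scale c (h A ((p, v) # B)) + h A ((p, w) # B)"
    if "mset A + mset B = mset vs" for A B
    using Nil(1)[of "[]" A B] Nil(2)[of "[]" B A] Nil(3) unshuffle_parts(4)[OF that]
    by (simp_all add: add.commute)
  have 2: "unshuffle_sum (\<lambda>A B. h ((p, scale c v + w) # A) B) vs =
    unshuffle_sum (\<lambda>A B. scale c (h ((p, v) # A) B) + h ((p, w) # A) B) vs"
    by (rule unshuffle_sum_cong) (simp add: 1)
  have 3: "unshuffle_sum (\<lambda>A B. signed (len A + p * deg A) (h A ((p, scale c v + w) # B))) vs =
    unshuffle_sum (\<lambda>A B. signed (len A + p * deg A) (scale c (h A ((p, v) # B)) + h A ((p, w) # B))) vs"
    by (rule unshuffle_sum_cong) (simp add: 1)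
  show ?case
    unfolding append_Nil unshuffle_sum.simps fst_conv 2 3
    by (simp add: unshuffle_sum_add signed_add signed_scale scale_right_distrib
      unshuffle_sum_additive[of "scale c", OF scale_right_distrib] algebra_simps)
next
  case (Cons x us)
  have 1: "unshuffle_sum (\<lambda>A B. h (x # A) B) (us @ (p, scale c v + w) # vs) =
      scale c (unshuffle_sum (\<lambda>A B. h (x # A) B) (us @ (p, v) # vs)) +
      unshuffle_sum (\<lambda>A B. h (x # A) B) (us @ (p, w) # vs)"
    by (rule Cons.IH[of "n - 1"]) (use Cons.prems(1)[of "x # _"] Cons.prems(2)[of _ _ "x # _"] Cons.prems(3) in simp_all)
  have 2: "unshuffle_sum (\<lambda>A B. signed (len A + fst x * deg A) (h A (x # B))) (us @ (p, scale c v + w) # vs) =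
      scale c (unshuffle_sum (\<lambda>A B. signed (len A + fst x * deg A) (h A (x # B))) (us @ (p, v) # vs)) +
      unshuffle_sum (\<lambda>A B. signed (len A + fst x * deg A) (h A (x # B))) (us @ (p, w) # vs)"
    by (rule Cons.IH[of "n - 1"])
      (use Cons.prems(1)[of _ _ "x # _"] Cons.prems(2)[of "x # _"] Cons.prems(3) in
        \<open>simp_all add: signed_add signed_scale\<close>)
  show ?case unfolding append_Cons unshuffle_sum.simps 1 2
    by (simp only: scale_right_distrib ac_simps)
qed

end

section \<open>Permutations and shuffles as lists of indices\<close>

text \<open>For the list of values of a permutation, this is the exponent of \<open>\<chi>\<close>: every inversion
  contributes the factor \<open>-(-1)\<^sup>a\<^sup>b\<close>.\<close>

fun inversion_exponent :: "(nat \<Rightarrow> int) \<Rightarrow> nat list \<Rightarrow> int" where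
  "inversion_exponent q [] = 0"
| "inversion_exponent q (y # m) = (\<Sum>z\<leftarrow>m. if z < y then 1 + q y * q z else 0) + inversion_exponent q m"

text \<open>The least index \<open>x\<close> is inverted with the indices in front of it, and with no others.\<close>

lemma inversion_exponent_insert:
  assumes "\<And>z. z \<in> set (A @ B) \<Longrightarrow> x < z"
  shows "inversion_exponent q (A @ x # B) = inversion_exponent q (A @ B) + (len A + q x * sum_list (map q A))"
  using assms
proof (induction A)
  case Nil
  have "(\<Sum>z\<leftarrow>B. if z < x then 1 + q x * q z else 0) = (\<Sum>z\<leftarrow>B. 0)"
    by (intro arg_cong[of _ _ sum_list] map_cong refl) (use Nil in force)
  then show ?case by simp
next
  case (Cons y A)
  have "inversion_exponent q (A @ x # B) = inversion_exponent q (A @ B) + (len A + q x * sum_list (map q A))"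
    using Cons.prems by (intro Cons.IH) auto
  moreover have "x < y" using Cons.prems by simp
  ultimately show ?case by (simp add: algebra_simps)
qed

lemma inversion_exponent_nth:
  "inversion_exponent q m = (\<Sum>i<length m. \<Sum>j<length m. if i < j \<and> m ! j < m ! i then 1 + q (m ! i) * q (m ! j) else 0)"
proof (induction m)
  case (Cons y m)
  have "(\<Sum>z\<leftarrow>m. if z < y then 1 + q y * q z else 0) = (\<Sum>j<length m. if m ! j < y then 1 + q y * q (m ! j) else 0)"
    by (simp add: sum_list_sum_nth atLeast0LessThan)
  then show ?case
    by (simp add: Cons sum.lessThan_Suc_shift del: sum.lessThan_Suc cong: if_cong)
qed simp

lemma prod_neg_msign: "(\<Prod>x\<in>S. - msign (f x)) = (msign (\<Sum>x\<in>S. 1 + f x) :: 'k::comm_ring_1)"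
  by (induction S rule: infinite_finite_induct) (auto simp: msign_def)

lemma wedge_sign_inversion_exponent:
  assumes "length ps = n"
  shows "wedge_sign \<sigma> ps = (msign (inversion_exponent ((!) ps) (map \<sigma> [0..<n])) :: 'k::comm_ring_1)"
proof -
  have "{(i, j). i < j \<and> j < length ps \<and> \<sigma> j < \<sigma> i} =
      {x \<in> {..<n} \<times> {..<n}. fst x < snd x \<and> \<sigma> (snd x) < \<sigma> (fst x)}"
    using assms by auto
  then have "(\<Sum>(i, j) \<in> {(i, j). i < j \<and> j < length ps \<and> \<sigma> j < \<sigma> i}. 1 + ps ! \<sigma> i * ps ! \<sigma> j) =
     (\<Sum>(i, j) \<in> {..<n} \<times> {..<n}. if i < j \<and> \<sigma> j < \<sigma> i then 1 + ps ! \<sigma> i * ps ! \<sigma> j else 0)"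
    by (simp add: sum.inter_filter case_prod_unfold)
  also have "\<dots> = inversion_exponent ((!) ps) (map \<sigma> [0..<n])"
    by (simp add: inversion_exponent_nth sum.cartesian_product[symmetric] cong: if_cong)
  finally show ?thesis
    by (simp add: wedge_sign_def case_prod_unfold prod_neg_msign)
qed

lemma finite_orderings: "finite {m. distinct m \<and> set m = set l}"
  by (rule finite_subset[OF _ finite_subset_distinct[of "set l"]]) auto

text \<open>By induction: an ordering of \<open>x # l\<close> arises from exactly one ordering of \<open>l\<close>, by inserting the
  least index \<open>x\<close> at one position.\<close>

lemma perm_sum_eq_sum_orderings:
  fixes e :: "nat \<Rightarrow> int \<times> 'b" and f :: "(int \<times> 'b) list \<Rightarrow> 'a::ab_group_add"
  assumes "sorted_wrt (<) l"
  shows "perm_sum f (map e l) =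
    (\<Sum>m | distinct m \<and> set m = set l. signed (inversion_exponent (\<lambda>i. fst (e i)) m) (f (map e m)))"
  using assms
proof (induction l arbitrary: f)
  case Nil
  have "{m :: nat list. distinct m \<and> m = []} = {[]}" by auto
  then show ?case by simp
next
  case (Cons x l)
  let ?q = "\<lambda>i. fst (e i)"
  let ?D = "\<lambda>l. {m :: nat list. distinct m \<and> set m = set l}"
  let ?ins = "\<lambda>(m, k). take k m @ x # drop k m"
  have x: "x < z" if "z \<in> set l" for z using Cons.prems that by simp
  then have xl: "x \<notin> set l" by blast
  have "perm_sum f (map e (x # l)) = (\<Sum>m\<in>?D l. signed (inversion_exponent ?q m) (insert_sum (e x) f (map e m)))"
    using Cons by simp
  also have "\<dots> = (\<Sum>m\<in>?D l. \<Sum>k\<le>length m. signed (inversion_exponent ?q (?ins (m, k))) (f (map e (?ins (m, k)))))"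
  proof (rule sum.cong[OF refl])
    fix m assume m: "m \<in> ?D l"
    have "signed (inversion_exponent ?q m + (int k + ?q x * deg (take k (map e m)))) v =
      signed (inversion_exponent ?q (?ins (m, k))) v" if "k \<le> length m" for k and v :: 'a
      using inversion_exponent_insert[of "take k m" "drop k m" x ?q] x m that
      by (simp add: deg_def take_map flip: set_append) (simp add: comp_def)
    then show "signed (inversion_exponent ?q m) (insert_sum (e x) f (map e m)) =
      (\<Sum>k\<le>length m. signed (inversion_exponent ?q (?ins (m, k))) (f (map e (?ins (m, k)))))"
      by (simp add: insert_sum_take_drop signed_sum signed_signed take_map drop_map)
  qed
  also have "\<dots> = (\<Sum>mk\<in>(SIGMA m:?D l. {..length m}). signed (inversion_exponent ?q (?ins mk)) (f (map e (?ins mk))))"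
    by (subst sum.Sigma) (simp_all add: finite_orderings case_prod_unfold)
  also have "\<dots> = (\<Sum>m\<in>?D (x # l). signed (inversion_exponent ?q m) (f (map e m)))"
  proof (rule sum.reindex_bij_witness[of _ "\<lambda>m. (remove1 x m, length (takeWhile (\<lambda>z. z \<noteq> x) m))" ?ins])
    fix mk assume "mk \<in> (SIGMA m:?D l. {..length m})"
    then obtain m k where mk: "mk = (m, k)" "distinct m" "set m = set l" "k \<le> length m" by auto
    then have nx: "x \<notin> set m" "x \<notin> set (take k m)" "x \<notin> set (drop k m)"
      using xl by (auto dest: in_set_takeD in_set_dropD)
    have tw: "takeWhile (\<lambda>z. z \<noteq> x) (take k m @ x # drop k m) = take k m"
      using nx by (subst takeWhile_append2) auto
    show "(remove1 x (?ins mk), length (takeWhile (\<lambda>z. z \<noteq> x) (?ins mk))) = mk"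
      using nx tw mk by (simp add: remove1_append)
    have "set (take k m) \<inter> set (drop k m) = {}"
      using mk(2) by (metis append_take_drop_id distinct_append)
    moreover have "set (take k m) \<union> set (drop k m) = set l"
      using mk(3) by (metis append_take_drop_id set_append)
    ultimately show "?ins mk \<in> ?D (x # l)"
      using nx mk by auto
  next
    fix m assume m: "m \<in> ?D (x # l)"
    then have "x \<in> set m" by auto
    then obtain A B where AB: "m = A @ x # B" "x \<notin> set A" by (meson split_list_first)
    have tw: "takeWhile (\<lambda>z. z \<noteq> x) m = A"
      unfolding AB using AB(2) by (subst takeWhile_append2) auto
    have rm: "remove1 x m = A @ B" using AB by (simp add: remove1_append)
    show "?ins (remove1 x m, length (takeWhile (\<lambda>z. z \<noteq> x) m)) = m"
      unfolding tw rm by (simp add: AB)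
    have "set A \<union> set B = set l" "distinct (A @ B)" using m xl unfolding AB by auto
    then show "(remove1 x m, length (takeWhile (\<lambda>z. z \<noteq> x) m)) \<in> (SIGMA m:?D l. {..length m})"
      unfolding tw rm by simp
  qed simp
  finally show ?case .
qed

text \<open>A permutation of positions is recorded by the list of its values.\<close>

lemma sum_permutes_eq_sum_orderings:
  "(\<Sum>\<sigma> | \<sigma> permutes {..<n}. g (map \<sigma> [0..<n])) = (\<Sum>m | distinct m \<and> set m = set [0..<n]. g m)"
proof (rule sum.reindex_bij_witness[of _ "\<lambda>m i. if i < n then m ! i else i" "\<lambda>\<sigma>. map \<sigma> [0..<n]"])
  fix \<sigma> assume \<sigma>: "\<sigma> \<in> {\<sigma>. \<sigma> permutes {..<n}}"
  then show "(\<lambda>i. if i < n then map \<sigma> [0..<n] ! i else i) = \<sigma>"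
    by (auto simp: fun_eq_iff permutes_def)
  show "map \<sigma> [0..<n] \<in> {m. distinct m \<and> set m = set [0..<n]}"
    using \<sigma> permutes_image[of \<sigma> "{..<n}"] permutes_inj[of \<sigma> "{..<n}"]
    by (auto simp: distinct_map atLeast0LessThan inj_on_def inj_def)
next
  fix m assume m: "m \<in> {m. distinct m \<and> set m = set [0..<n]}"
  then have len: "length m = n" using distinct_card[of m] by simp
  then show "map (\<lambda>i. if i < n then m ! i else i) [0..<n] = m"
    by (intro nth_equalityI) auto
  have "bij_betw ((!) m) {..<n} {..<n}"
    using m len by (intro bij_betw_nth) (auto simp: atLeast0LessThan)
  then have "bij_betw (\<lambda>i. if i < n then m ! i else i) {..<n} {..<n}"
    by (rule bij_betw_cong[THEN iffD1, rotated]) simp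
  then show "(\<lambda>i. if i < n then m ! i else i) \<in> {\<sigma>. \<sigma> permutes {..<n}}"
    by (intro CollectI bij_imp_permutes) (auto split: if_splits)
qed simp

lemma (in module) antisymmetrize_eq_perm_sum:
  assumes "length ps = length xs"
  shows "antisymmetrize scale F ps xs = perm_sum (\<lambda>l. F (map fst l) (map snd l)) (zip ps xs)"
proof -
  define n where "n = length xs"
  have n: "length xs = n" "length ps = n" using assms by (simp_all add: n_def)
  define e where "e = (\<lambda>i. (ps ! i, xs ! i))"
  have z: "zip ps xs = map e [0..<n]"
    by (rule nth_equalityI) (simp_all add: n e_def)
  have "antisymmetrize scale F ps xs = (\<Sum>\<sigma> | \<sigma> permutes {..<n}.
     signed (inversion_exponent (\<lambda>i. fst (e i)) (map \<sigma> [0..<n]))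
       (F (map fst (map e (map \<sigma> [0..<n]))) (map snd (map e (map \<sigma> [0..<n])))))"
    unfolding antisymmetrize_def n
    by (rule sum.cong) (simp_all add: wedge_sign_inversion_exponent[OF n(2)] scale_msign
        permute_list_def n e_def comp_def)
  also have "\<dots> = perm_sum (\<lambda>l. F (map fst l) (map snd l)) (map e [0..<n])"
    unfolding perm_sum_eq_sum_orderings[of "[0..<n]" for n, simplified sorted_wrt_upt, OF TrueI]
    by (rule sum_permutes_eq_sum_orderings)
  finally show ?thesis by (simp only: z)
qed

text \<open>A shuffle is recorded by the two increasing lists of its values.\<close>

definition sorted_splittings :: "nat list \<Rightarrow> (nat list \<times> nat list) set" where
  "sorted_splittings l = {(A, B). sorted_wrt (<) A \<and> sorted_wrt (<) B \<and> distinct (A @ B) \<and> set (A @ B) = set l}"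

lemma finite_sorted_splittings: "finite (sorted_splittings l)"
  by (rule finite_subset[of _ "{m. set m \<subseteq> set l \<and> distinct m} \<times> {m. set m \<subseteq> set l \<and> distinct m}"])
    (auto simp: sorted_splittings_def intro!: finite_subset_distinct)

text \<open>The least index has to be the head of one of the two increasing lists. This matches the two
  summands in the recursion for unshuffles.\<close>

lemma sorted_splittings_Cons:
  assumes "sorted_wrt (<) (x # l)"
  shows "sorted_splittings (x # l) =
    (\<lambda>(A, B). (x # A, B)) ` sorted_splittings l \<union> (\<lambda>(A, B). (A, x # B)) ` sorted_splittings l"
proof -
  have x: "x < z" if "z \<in> set l" for z using assms that by simp
  then have xl: "x \<notin> set l" by blast
  have min: "\<exists>A'. A = x # A'" if "sorted_wrt (<) A" "x \<in> set A" "set A \<subseteq> set (x # l)" for A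
    using that x by (cases A) (auto, fastforce+)
  show ?thesis
  proof (rule set_eqI; rule iffI)
    fix AB assume "AB \<in> sorted_splittings (x # l)"
    then obtain A B where AB: "AB = (A, B)" "sorted_wrt (<) A" "sorted_wrt (<) B" "distinct (A @ B)"
      "set A \<union> set B = set (x # l)" by (auto simp: sorted_splittings_def)
    then consider "x \<in> set A" | "x \<in> set B" by auto
    then show "AB \<in> (\<lambda>(A, B). (x # A, B)) ` sorted_splittings l \<union> (\<lambda>(A, B). (A, x # B)) ` sorted_splittings l"
    proof cases
      case 1
      then obtain A' where "A = x # A'" using min[of A] AB by auto
      then have "(A', B) \<in> sorted_splittings l" using AB xl unfolding sorted_splittings_def by auto
      then show ?thesis using AB \<open>A = x # A'\<close> by force
    next
      case 2
      then obtain B' where "B = x # B'" using min[of B] AB by auto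
      then have "(A, B') \<in> sorted_splittings l" using AB xl unfolding sorted_splittings_def by auto
      then show ?thesis using AB \<open>B = x # B'\<close> by force
    qed
  qed (use xl in \<open>auto simp: sorted_splittings_def\<close>, (blast intro: x)+)
qed

lemma unshuffle_sum_eq_sum_splittings:
  fixes e :: "nat \<Rightarrow> int \<times> 'b" and h :: "(int \<times> 'b) list \<Rightarrow> (int \<times> 'b) list \<Rightarrow> 'a::ab_group_add"
  assumes "sorted_wrt (<) l"
  shows "unshuffle_sum h (map e l) = (\<Sum>(A, B) \<in> sorted_splittings l.
     signed (inversion_exponent (\<lambda>i. fst (e i)) (A @ B)) (h (map e A) (map e B)))"
  using assms
proof (induction l arbitrary: h)
  case Nil
  have "sorted_splittings [] = {([], [])}" by (auto simp: sorted_splittings_def)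
  then show ?case by simp
next
  case (Cons x l)
  let ?q = "\<lambda>i. fst (e i)"
  have x: "x < z" if "z \<in> set l" for z using Cons.prems that by simp
  then have xl: "x \<notin> set l" by blast
  have 1: "inversion_exponent ?q ((x # A) @ B) = inversion_exponent ?q (A @ B)"
    "inversion_exponent ?q (A @ x # B) = inversion_exponent ?q (A @ B) + (len (map e A) + ?q x * deg (map e A))"
    if "(A, B) \<in> sorted_splittings l" for A B
  proof -
    have "x < z" if "z \<in> set (A @ B)" for z
      using \<open>(A, B) \<in> sorted_splittings l\<close> x that by (auto simp: sorted_splittings_def)
    then show "inversion_exponent ?q ((x # A) @ B) = inversion_exponent ?q (A @ B)"
      "inversion_exponent ?q (A @ x # B) = inversion_exponent ?q (A @ B) + (len (map e A) + ?q x * deg (map e A))"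
      using inversion_exponent_insert[of "[]" "A @ B" x ?q] inversion_exponent_insert[of A B x ?q]
      by (simp_all add: deg_def comp_def)
  qed
  have inj: "inj_on (\<lambda>(A, B). (x # A, B)) S" "inj_on (\<lambda>(A, B). (A, x # B)) S" for S :: "(nat list \<times> nat list) set"
    by (auto simp: inj_on_def)
  have "(\<lambda>(A, B). (x # A, B)) ` sorted_splittings l \<inter> (\<lambda>(A, B). (A, x # B)) ` sorted_splittings l = {}"
    using xl by (auto simp: sorted_splittings_def)
  then show ?case
    by (simp add: sorted_splittings_Cons[OF Cons.prems] sum.union_disjoint finite_sorted_splittings
        sum.reindex inj Cons.IH[OF sorted_wrt.simps(2)[THEN iffD1, OF Cons.prems, THEN conjunct2]])
      (auto simp: 1[simplified append_Cons] signed_signed case_prod_unfold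
        simp del: inversion_exponent.simps intro!: arg_cong2[of _ _ _ _ "(+)"] sum.cong)
qed

lemma sum_Sh_eq_unshuffle_sum:
  fixes e :: "nat \<Rightarrow> int \<times> 'b" and h :: "(int \<times> 'b) list \<Rightarrow> (int \<times> 'b) list \<Rightarrow> 'a::ab_group_add"
  assumes "k \<le> n"
  shows "(\<Sum>\<sigma> \<in> Sh k n. signed (inversion_exponent (\<lambda>i. fst (e i)) (map \<sigma> [0..<n]))
      (h (take k (map e (map \<sigma> [0..<n]))) (drop k (map e (map \<sigma> [0..<n]))))) =
    unshuffle_sum (\<lambda>A B. if length A = k then h A B else 0) (map e [0..<n])"
proof -
  let ?q = "\<lambda>i. fst (e i)"
  let ?S = "{AB \<in> sorted_splittings [0..<n]. length (fst AB) = k}"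
  have "unshuffle_sum (\<lambda>A B. if length A = k then h A B else 0) (map e [0..<n]) =
     (\<Sum>AB \<in> ?S. signed (inversion_exponent ?q (fst AB @ snd AB)) (h (map e (fst AB)) (map e (snd AB))))"
    by (simp add: unshuffle_sum_eq_sum_splittings sum.inter_filter[OF finite_sorted_splittings])
      (auto intro!: sum.cong)
  also have "\<dots> = (\<Sum>\<sigma> \<in> Sh k n. signed (inversion_exponent ?q (map \<sigma> [0..<n]))
      (h (take k (map e (map \<sigma> [0..<n]))) (drop k (map e (map \<sigma> [0..<n])))))"
  proof (rule sum.reindex_bij_witness[of _ "\<lambda>\<sigma>. (take k (map \<sigma> [0..<n]), drop k (map \<sigma> [0..<n]))"
        "\<lambda>AB i. if i < n then (fst AB @ snd AB) ! i else i"])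
    fix AB assume "AB \<in> ?S"
    then obtain A B where AB: "AB = (A, B)" "sorted_wrt (<) A" "sorted_wrt (<) B" "distinct (A @ B)"
      "set (A @ B) = {..<n}" "length A = k"
      by (auto simp: sorted_splittings_def atLeast0LessThan)
    let ?\<sigma> = "\<lambda>i. if i < n then (A @ B) ! i else i"
    have len: "length (A @ B) = n" using AB distinct_card[of "A @ B"] by simp
    have m: "map ?\<sigma> [0..<n] = A @ B" by (rule nth_equalityI) (use len in auto)
    show "(take k (map (\<lambda>i. if i < n then (fst AB @ snd AB) ! i else i) [0..<n]),
        drop k (map (\<lambda>i. if i < n then (fst AB @ snd AB) ! i else i) [0..<n])) = AB"
      using AB unfolding AB(1) fst_conv snd_conv m by simp
    have "bij_betw ((!) (A @ B)) {..<n} {..<n}" using AB len by (intro bij_betw_nth) auto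
    then have "bij_betw ?\<sigma> {..<n} {..<n}"
      by (rule bij_betw_cong[THEN iffD1, rotated]) simp
    then have "?\<sigma> permutes {..<n}" by (intro bij_imp_permutes) (auto split: if_splits)
    moreover have "strict_mono_on {..<k} ?\<sigma>"
      using AB(2,6) len by (auto simp: strict_mono_on_def nth_append sorted_wrt_iff_nth_less)
    moreover have "strict_mono_on {k..<n} ?\<sigma>"
      using AB(3,6) len by (auto simp: strict_mono_on_def nth_append sorted_wrt_iff_nth_less)
    ultimately show "(\<lambda>i. if i < n then (fst AB @ snd AB) ! i else i) \<in> Sh k n"
      unfolding AB(1) fst_conv snd_conv Sh_def by simp
    show "signed (inversion_exponent ?q (map (\<lambda>i. if i < n then (fst AB @ snd AB) ! i else i) [0..<n]))
      (h (take k (map e (map (\<lambda>i. if i < n then (fst AB @ snd AB) ! i else i) [0..<n])))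
       (drop k (map e (map (\<lambda>i. if i < n then (fst AB @ snd AB) ! i else i) [0..<n])))) =
      signed (inversion_exponent ?q (fst AB @ snd AB)) (h (map e (fst AB)) (map e (snd AB)))"
      using AB unfolding AB(1) fst_conv snd_conv m by simp
  next
    fix \<sigma> assume \<sigma>: "\<sigma> \<in> Sh k n"
    then have p: "\<sigma> permutes {..<n}" by (simp add: Sh_def)
    then show "(\<lambda>i. if i < n then (fst (take k (map \<sigma> [0..<n]), drop k (map \<sigma> [0..<n])) @
        snd (take k (map \<sigma> [0..<n]), drop k (map \<sigma> [0..<n]))) ! i else i) = \<sigma>"
      by (auto simp: fun_eq_iff permutes_def)
    have "distinct (map \<sigma> [0..<n])" "set (map \<sigma> [0..<n]) = {..<n}"
      using permutes_image[OF p] permutes_inj[OF p]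
      by (auto simp: distinct_map atLeast0LessThan inj_on_def inj_def)
    then have "distinct (take k (map \<sigma> [0..<n]) @ drop k (map \<sigma> [0..<n]))"
      "set (take k (map \<sigma> [0..<n]) @ drop k (map \<sigma> [0..<n])) = {..<n}"
      by (simp_all only: append_take_drop_id)
    moreover have "\<sigma> (k + i) < \<sigma> (k + j)" if "i < j" "j < n - k" for i j
      using \<sigma> that by (intro strict_mono_onD[of "{k..<n}" \<sigma>]) (auto simp: Sh_def)
    then have "sorted_wrt (<) (take k (map \<sigma> [0..<n]))" "sorted_wrt (<) (drop k (map \<sigma> [0..<n]))"
      using \<sigma> assms by (auto simp: sorted_wrt_iff_nth_less Sh_def strict_mono_on_def)
    ultimately show "(take k (map \<sigma> [0..<n]), drop k (map \<sigma> [0..<n])) \<in> ?S"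
      using assms by (simp add: sorted_splittings_def atLeast0LessThan
        del: set_append distinct_append append_take_drop_id)
  qed
  finally show ?thesis by simp
qed

section \<open>Sums over plane binary trees\<close>

lemma Ot_0: "Ot 0 = {}"
  by (auto simp: Ot_def size1_size)

lemma Ot_1: "Ot (Suc 0) = {Leaf}"
  by (auto simp: Ot_def size1_size)

lemma sum_Ot:
  assumes "n \<ge> 2"
  shows "(\<Sum>\<phi>\<in>Ot n. f \<phi>) = (\<Sum>k\<le>n. \<Sum>\<phi>1\<in>Ot k. \<Sum>\<phi>2\<in>Ot (n - k). f (Node \<phi>1 () \<phi>2))"
proof -
  have "(\<Sum>k\<le>n. \<Sum>\<phi>1\<in>Ot k. \<Sum>\<phi>2\<in>Ot (n - k). f (Node \<phi>1 () \<phi>2)) =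
    (\<Sum>(k, \<phi>1, \<phi>2)\<in>(SIGMA k:{..n}. Ot k \<times> Ot (n - k)). f (Node \<phi>1 () \<phi>2))"
    by (simp add: sum.Sigma sum.cartesian_product finite_Ot)
  also have "\<dots> = (\<Sum>\<phi>\<in>Ot n. f \<phi>)"
  proof (rule sum.reindex_bij_witness[of _ "\<lambda>\<phi>. (size1 (left \<phi>), left \<phi>, right \<phi>)"
        "\<lambda>(k, \<phi>1, \<phi>2). Node \<phi>1 () \<phi>2"])
    fix \<phi> assume "\<phi> \<in> Ot n"
    then obtain \<phi>1 \<phi>2 where "\<phi> = Node \<phi>1 () \<phi>2" "size1 \<phi>1 + size1 \<phi>2 = n"
      using assms by (cases \<phi>) (auto simp: Ot_def)
    then show "(case (size1 (left \<phi>), left \<phi>, right \<phi>) of (k, \<phi>1, \<phi>2) \<Rightarrow> Node \<phi>1 () \<phi>2) = \<phi>"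
      "(size1 (left \<phi>), left \<phi>, right \<phi>) \<in> (SIGMA k:{..n}. Ot k \<times> Ot (n - k))"
      by (auto simp: Ot_def)
  qed (auto simp: Ot_def)
  finally show ?thesis by simp
qed

definition tree_weight :: "'b tree \<Rightarrow> int" where
  "tree_weight \<phi> = (\<Sum>i < size1 \<phi>. leaf_weight \<phi> i)"

lemma tree_weight_Leaf: "tree_weight Leaf = 0"
  by (simp add: tree_weight_def leaf_weight_def)

lemma tree_sign_weight: "tree_sign \<phi> = msign (tree_weight \<phi>)"
  by (cases "\<phi> = Leaf") (simp add: tree_sign_def tree_weight_Leaf msign_def,
    simp add: tree_sign_def tree_weight_def)

lemma length_smaller_ramifications: "length (smaller_ramifications \<phi>) = size1 \<phi>"
  by (induction \<phi>) simp_all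

lemma sum_lessThan_add: "(\<Sum>i<a + b. f i) = (\<Sum>i<a. f i) + (\<Sum>i<b. f (a + i :: nat))"
  by (induction b) (simp_all add: add.assoc)

text \<open>Passing from \<open>l\<close> to the whole tree, every leaf of \<open>l\<close> gets one more left step. For a leaf of \<open>r\<close>,
  the root and the ramifications of \<open>l\<close> are additional smaller ramifications; there are as many of
  them as leaves of \<open>l\<close>, which shift its number, so its weight remains the same.\<close>

lemma tree_weight_Node: "tree_weight (Node l x r) = tree_weight l + tree_weight r + int (size1 l)"
proof -
  have "tree_weight (Node l x r) = (\<Sum>i < size1 l. leaf_weight (Node l x r) i) +
     (\<Sum>i < size1 r. leaf_weight (Node l x r) (size1 l + i))"
    by (simp add: tree_weight_def sum_lessThan_add)
  also have "(\<Sum>i < size1 l. leaf_weight (Node l x r) i) = (\<Sum>i < size1 l. leaf_weight l i + 1)"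
    by (intro sum.cong) (simp_all add: leaf_weight_def nth_append length_smaller_ramifications)
  also have "(\<Sum>i < size1 r. leaf_weight (Node l x r) (size1 l + i)) = (\<Sum>i < size1 r. leaf_weight r i)"
    by (intro sum.cong) (simp_all add: leaf_weight_def nth_append length_smaller_ramifications size1_size)
  finally show ?thesis by (simp add: tree_weight_def sum.distrib)
qed

text \<open>The sum of \<open>e(\<phi>) \<phi>(g,\<dots>,g)\<close> over all trees. It vanishes on the empty list, as there is no tree
  without leaves; the recursions below may therefore range over all splittings, including those with
  an empty part.\<close>

definition tree_sum :: "('k::ring_1 \<Rightarrow> 'b::ab_group_add \<Rightarrow> 'b) \<Rightarrow> ('b \<Rightarrow> 'b \<Rightarrow> 'b) \<Rightarrow> (int \<times> 'b) list \<Rightarrow> 'b" where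
  "tree_sum scale g l = (\<Sum>\<phi>\<in>Ot (length l). signed (tree_weight \<phi>)
     (tree_map scale (map_tree (\<lambda>_. (-1, g)) \<phi>) (map fst l) (map snd l)))"

context module
begin

lemma tree_degree_map: "tree_degree (map_tree (\<lambda>_. (-1, g)) \<phi>) = - int (size \<phi>)"
  by (induction \<phi>) (simp_all add: tree_degree_def)

text \<open>A tree is cut at its root. The exponent collects the weight \<open>len A\<close> gained by the leaves of the
  left subtree and the Koszul sign: the right subtree has \<open>len B - 1\<close> ramifications, so its map has
  degree \<open>1 - len B\<close>.\<close>

lemma root_tree_sum:
  assumes b: "\<And>x y z. b (x + y) z = b x z + b y z" "\<And>x y z. b x (y + z) = b x y + b x z"
    and l: "length l \<ge> 2"
  shows "(\<Sum>\<phi>\<in>Ot (length l). signed (tree_weight \<phi>)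
      (tree_map scale (root_label (r, b) (-1, g) \<phi>) (map fst l) (map snd l))) =
    split_sum (\<lambda>A B. signed (len A + (1 - len B) * deg A) (b (tree_sum scale g A) (tree_sum scale g B))) l"
proof -
  have bl: "additive (\<lambda>x. b x y)" and br: "additive (b x)" for x y
    by (simp_all add: additive_def b)
  have bs: "b (signed k v) y = signed k (b v y)" "b x (signed k v) = signed k (b x v)" for k v x y
    by (simp_all add: signed_def additive.minus[OF bl] additive.minus[OF br])
  have bsum: "b (\<Sum>x\<in>S. f x) (\<Sum>y\<in>T. f' y) = (\<Sum>x\<in>S. \<Sum>y\<in>T. b (f x) (f' y))"
    for S T :: "unit tree set" and f f'
    by (simp only: additive.sum[OF bl]) (simp only: additive.sum[OF br])
  have key: "(\<Sum>\<phi>1\<in>Ot k. \<Sum>\<phi>2\<in>Ot (length l - k). signed (tree_weight (Node \<phi>1 () \<phi>2))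
      (tree_map scale (root_label (r, b) (-1, g) (Node \<phi>1 () \<phi>2)) (map fst l) (map snd l))) =
    signed (int k + (1 - int (length l - k)) * deg (take k l))
      (b (tree_sum scale g (take k l)) (tree_sum scale g (drop k l)))" if "k \<le> length l" for k
    unfolding tree_sum_def bsum signed_sum
  proof (intro sum.cong)
    fix \<phi>1 \<phi>2 :: "unit tree"
    assume "\<phi>1 \<in> Ot (length (take k l))" "\<phi>2 \<in> Ot (length (drop k l))"
    then have s: "size1 \<phi>1 = k" "size1 \<phi>2 = length l - k" using that by (simp_all add: Ot_def)
    then have s2: "int (size \<phi>2) = int (length l - k) - 1" by (simp add: size1_size)
    show "signed (tree_weight (Node \<phi>1 () \<phi>2))
      (tree_map scale (root_label (r, b) (-1, g) (Node \<phi>1 () \<phi>2)) (map fst l) (map snd l)) =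
      signed (int k + (1 - int (length l - k)) * deg (take k l))
       (b (signed (tree_weight \<phi>1) (tree_map scale (map_tree (\<lambda>_. (-1, g)) \<phi>1) (map fst (take k l)) (map snd (take k l))))
        (signed (tree_weight \<phi>2) (tree_map scale (map_tree (\<lambda>_. (-1, g)) \<phi>2) (map fst (drop k l)) (map snd (drop k l)))))"
      by (simp add: s tree_weight_Node scale_msign bs signed_signed tree_degree_map s2 deg_def take_map drop_map Let_def)
        (rule signed_cong, simp add: take_map algebra_simps)
  qed (use that in simp_all)
  show ?thesis
    unfolding sum_Ot[OF l] split_sum_take_drop
    by (intro sum.cong refl, subst key) (simp_all add: min_absorb2)
qed

lemma tree_sum_rec:
  assumes g: "\<And>x y z. g (x + y) z = g x z + g y z" "\<And>x y z. g x (y + z) = g x y + g x z"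
  shows "tree_sum scale g l = (case l of [x] \<Rightarrow> snd x | _ \<Rightarrow> 0) +
    split_sum (\<lambda>A B. signed (len A + (1 - len B) * deg A) (g (tree_sum scale g A) (tree_sum scale g B))) l"
proof -
  interpret l: additive "\<lambda>x. g x y" for y by standard (rule g)
  interpret r: additive "g x" for x by standard (rule g)
  have 0: "tree_sum scale g [] = 0" by (simp add: tree_sum_def Ot_0)
  consider "l = []" | x where "l = [x]" | "length l \<ge> 2"
    by (cases l; cases "tl l") auto
  then show ?thesis
  proof cases
    case 3
    have "map_tree (\<lambda>_. (-1 :: int, g)) \<phi> = root_label (-1, g) (-1, g) \<phi>" for \<phi> :: "unit tree"
      by (cases \<phi>) simp_all
    then have "tree_sum scale g l = (\<Sum>\<phi>\<in>Ot (length l). signed (tree_weight \<phi>)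
        (tree_map scale (root_label (-1, g) (-1, g) \<phi>) (map fst l) (map snd l)))"
      by (simp only: tree_sum_def)
    also note root_tree_sum[OF g 3, of "-1" g]
    finally have "tree_sum scale g l =
      split_sum (\<lambda>A B. signed (len A + (1 - len B) * deg A) (g (tree_sum scale g A) (tree_sum scale g B))) l" .
    moreover have "(case l of [x] \<Rightarrow> snd x | _ \<Rightarrow> 0) = 0" using 3 by (auto split: list.split)
    ultimately show ?thesis by simp
  qed (simp_all add: 0 l.zero r.zero, simp add: tree_sum_def Ot_1 tree_weight_Leaf)
qed

end

lemma perm_sum_sum: "perm_sum (\<lambda>l. \<Sum>x\<in>S. f x l) l = (\<Sum>x\<in>S. perm_sum (f x) l)"
  by (induction S rule: infinite_finite_induct) (simp_all add: perm_sum_add)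

section \<open>The tree sums and their recursion\<close>

lemma unshuffle_sum_mem:
  assumes "\<And>A B. mset A + mset B = mset l \<Longrightarrow> h A B \<in> S"
    and "\<And>v w. v \<in> S \<Longrightarrow> w \<in> S \<Longrightarrow> v + w \<in> S" and "\<And>v. v \<in> S \<Longrightarrow> - v \<in> S"
  shows "unshuffle_sum h l \<in> S"
  using assms(1)
proof (induction l arbitrary: h)
  case (Cons x l)
  have "signed k v \<in> S" if "v \<in> S" for k v using that assms(3) by (simp add: signed_def)
  then show ?case using Cons by (simp add: assms(2))
qed simp

locale dg_lie_contraction = dg_lie_algebra scale G d br
  for scale :: "'k::comm_ring_1 \<Rightarrow> 'a::ab_group_add \<Rightarrow> 'a" and G :: "int \<Rightarrow> 'a set"
    and d :: "'a \<Rightarrow> 'a" and br :: "'a \<Rightarrow> 'a \<Rightarrow> 'a" +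
  fixes \<iota> :: "rat \<Rightarrow> 'k" and \<eta> :: "'a \<Rightarrow> 'a"
  assumes rat_embedding: "rat_embedding \<iota>"
    and eta_linear: "module_hom scale scale \<eta>"
    and eta_degree: "x \<in> G p \<Longrightarrow> \<eta> x \<in> G (p - 1)"
    and d_eta_d: "d (\<eta> (d x)) = d x"
    and eta_eta: "\<eta> (\<eta> x) = 0"
    and eta_d_eta: "\<eta> (d (\<eta> x)) = \<eta> x"
begin

lemmas d_simps = module_hom.add[OF d_linear] module_hom.scale[OF d_linear] module_hom.neg[OF d_linear]
  module_hom.diff[OF d_linear] module_hom.zero[OF d_linear]
lemmas eta_simps = module_hom.add[OF eta_linear] module_hom.scale[OF eta_linear] module_hom.neg[OF eta_linear]
  module_hom.diff[OF eta_linear] module_hom.zero[OF eta_linear]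
lemmas br_simps = module_hom.add[OF br_linear_left] module_hom.scale[OF br_linear_left]
  module_hom.neg[OF br_linear_left] module_hom.diff[OF br_linear_left] module_hom.zero[OF br_linear_left]
  module_hom.add[OF br_linear_right] module_hom.scale[OF br_linear_right]
  module_hom.neg[OF br_linear_right] module_hom.diff[OF br_linear_right] module_hom.zero[OF br_linear_right]

lemmas hom_simps = d_simps eta_simps br_simps

text \<open>The projection \<open>1 - [d,\<eta>]\<close> onto the harmonic elements.\<close>

definition proj :: "'a \<Rightarrow> 'a" where
  "proj x = x - comm_d_eta d \<eta> x"

lemma proj_simps: "proj (x + y) = proj x + proj y" "proj (scale c x) = scale c (proj x)" "proj (- x) = - proj x"
  "proj 0 = 0"
  by (simp_all add: proj_def comm_d_eta_def hom_simps scale_right_diff_distrib scale_right_distrib)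

lemma hom_signed: "d (signed k x) = signed k (d x)" "\<eta> (signed k x) = signed k (\<eta> x)"
  "br (signed k x) y = signed k (br x y)" "br x (signed k y) = signed k (br x y)"
  "proj (signed k x) = signed k (proj x)"
  by (simp_all add: signed_def hom_simps proj_simps)

lemma d_proj: "d (proj x) = 0" and eta_proj: "\<eta> (proj x) = 0" and proj_d: "proj (d x) = 0"
  by (simp_all add: proj_def comm_d_eta_def hom_simps d_d d_eta_d eta_eta eta_d_eta)

lemma degree_simps: "0 \<in> G p" "x \<in> G p \<Longrightarrow> y \<in> G p \<Longrightarrow> x + y \<in> G p" "x \<in> G p \<Longrightarrow> y \<in> G p \<Longrightarrow> x - y \<in> G p"
  "x \<in> G p \<Longrightarrow> - x \<in> G p" "x \<in> G p \<Longrightarrow> scale c x \<in> G p" "x \<in> G p \<Longrightarrow> signed k x \<in> G p"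
  using subspace_degree[of p] by (auto simp: subspace_0 subspace_add subspace_diff subspace_neg subspace_scale signed_def)

lemma proj_degree: "x \<in> G p \<Longrightarrow> proj x \<in> G p"
  using d_degree[OF eta_degree, of x p] eta_degree[OF d_degree, of x p]
  by (simp add: proj_def comm_d_eta_def degree_simps)

text \<open>Applying \<open>d\<close> and \<open>\<eta>\<close> to \<open>[d,\<eta>] x = 0\<close> gives \<open>d x = 0\<close> and \<open>\<eta> x = 0\<close>, because \<open>d \<eta> d = d\<close> and
  \<open>\<eta> d \<eta> = \<eta>\<close>.\<close>

lemma harmonic_iff: "x \<in> harmonic d \<eta> \<longleftrightarrow> d x = 0 \<and> \<eta> x = 0"
proof
  assume "x \<in> harmonic d \<eta>"
  then have "comm_d_eta d \<eta> x = 0" by (simp add: harmonic_def)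
  then have *: "d (\<eta> x) + \<eta> (d x) = 0" by (simp only: comm_d_eta_def)
  have "d (d (\<eta> x) + \<eta> (d x)) = d x" "\<eta> (d (\<eta> x) + \<eta> (d x)) = \<eta> x"
    by (simp_all add: hom_simps d_d d_eta_d eta_eta eta_d_eta)
  then show "d x = 0 \<and> \<eta> x = 0" unfolding * by (simp add: hom_simps)
qed (simp add: harmonic_def comm_d_eta_def hom_simps)

lemma proj_harmonic: "proj x \<in> harmonic d \<eta>"
  by (simp add: harmonic_iff d_proj eta_proj)

lemma iota_simps: "\<iota> 1 = 1" "\<iota> (x + y) = \<iota> x + \<iota> y" "\<iota> (x * y) = \<iota> x * \<iota> y"
  using rat_embedding by (auto simp: rat_embedding_def)

lemma iota_0: "\<iota> 0 = 0"
  using iota_simps(2)[of 0 0] by simp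

lemma iota_minus: "\<iota> (- x) = - \<iota> x"
  using iota_simps(2)[of x "- x"] by (simp add: iota_0 add.commute eq_neg_iff_add_eq_0)

definition half :: "'a \<Rightarrow> 'a" where
  "half x = scale (\<iota> (1 / 2)) x"

lemma half_double: "half (x + x) = x"
proof -
  have "\<iota> (1 / 2) + \<iota> (1 / 2) = 1" by (simp flip: iota_simps)
  then show ?thesis by (simp add: half_def scale_right_distrib flip: scale_left_distrib)
qed

lemma half_simps: "half (x + y) = half x + half y" "half (- x) = - half x" "half 0 = 0"
  "d (half x) = half (d x)" "\<eta> (half x) = half (\<eta> x)" "br (half x) y = half (br x y)"
  "br x (half y) = half (br x y)" "proj (half x) = half (proj x)" "signed k (half x) = half (signed k x)"
  by (simp_all add: half_def scale_right_distrib hom_simps proj_simps signed_scale)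

lemma triple_eq_0:
  fixes x :: 'a
  assumes "x + x + x = 0"
  shows "x = 0"
proof -
  have "\<iota> (1 / 3) + \<iota> (1 / 3) + \<iota> (1 / 3) = 1" by (simp flip: iota_simps)
  then have "scale (\<iota> (1 / 3)) (x + x + x) = x"
    by (simp add: scale_right_distrib flip: scale_left_distrib)
  then show ?thesis by (simp add: assms)
qed

text \<open>The antisymmetrized tree sums \<open>\<Phi>\<close>, with \<open>g\<close> at every ramification. On harmonic arguments they
  are, up to sign conventions, the components of the L-infinity quasi-isomorphism from the harmonic
  elements to \<open>L\<close>.\<close>

definition Phi :: "(int \<times> 'a) list \<Rightarrow> 'a" where
  "Phi l = scale (\<iota> ((- 1 / 2) ^ (length l - 1))) (perm_sum (tree_sum scale (\<lambda>x y. \<eta> (br x y))) l)"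

text \<open>The exponent produced by cutting a tree at its root.\<close>

definition split_sign :: "(int \<times> 'a) list \<Rightarrow> (int \<times> 'a) list \<Rightarrow> int" where
  "split_sign A B = len A + (1 - len B) * deg A"

text \<open>The bracket \<open>[X,\<Phi>]\<close> with the arguments distributed over both sides. In the language of
  generating functions, it is the bracket of an element \<open>X\<close> with the degree one element \<open>\<Phi>\<close>.\<close>

definition left_br :: "((int \<times> 'a) list \<Rightarrow> 'a) \<Rightarrow> (int \<times> 'a) list \<Rightarrow> 'a" where
  "left_br X l = unshuffle_sum (\<lambda>A B. signed (split_sign A B) (br (X A) (Phi B))) l"

abbreviation Br :: "(int \<times> 'a) list \<Rightarrow> 'a" where
  "Br \<equiv> left_br Phi"

text \<open>The transferred brackets on homogeneous arguments, in terms of \<open>\<Phi>\<close>. That they agree with the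
  tree formula is the content of \<open>transferred_summand_eq_mu\<close>.\<close>

definition mu :: "(int \<times> 'a) list \<Rightarrow> 'a" where
  "mu l = - half (proj (Br l))"

lemma Phi_Nil: "Phi [] = 0"
  by (simp add: Phi_def tree_sum_def Ot_0)

lemma perm_sum_bilinear:
  assumes "\<And>x y z. b (x + y) z = b x z + b y z" "\<And>x y z. b x (y + z) = b x y + b x z"
  shows "perm_sum (\<lambda>A'. perm_sum (\<lambda>B'. signed (split_sign A' B') (b (T A') (T B'))) B) A =
    signed (split_sign A B) (b (perm_sum T A) (perm_sum T B))"
proof -
  have "perm_sum (\<lambda>A'. perm_sum (\<lambda>B'. signed (split_sign A' B') (b (T A') (T B'))) B) A =
    perm_sum (\<lambda>A'. perm_sum (\<lambda>B'. signed (split_sign A B) (b (T A') (T B'))) B) A"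
  proof (intro perm_sum_cong)
    fix A' B' assume "mset A' = mset A" "mset B' = mset B"
    then show "signed (split_sign A' B') (b (T A') (T B')) = signed (split_sign A B) (b (T A') (T B'))"
      using unshuffle_parts(1,2)[of A' "[]" A] unshuffle_parts(1,2)[of B' "[]" B]
      by (simp add: split_sign_def)
  qed
  also have "\<dots> = signed (split_sign A B) (perm_sum (\<lambda>A'. perm_sum (\<lambda>B'. b (T A') (T B')) B) A)"
    by (simp only: perm_sum_signed)
  also have "\<dots> = signed (split_sign A B) (b (perm_sum T A) (perm_sum T B))"
    by (subst perm_sum_additive[of "\<lambda>x. b x (perm_sum T B)"])
      (simp_all add: assms perm_sum_additive[of "b _"])
  finally show ?thesis .
qed

text \<open>Joining trees with \<open>m - 1\<close> and \<open>n - 1\<close> ramifications adds one ramification, hence one more factor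
  \<open>- 1 / 2\<close>.\<close>

lemma coefficient_product:
  assumes "m > 0" "n > 0"
  shows "\<iota> ((- 1 / 2) ^ (m + n - 1)) = - \<iota> (1 / 2) * \<iota> ((- 1 / 2) ^ (m - 1)) * \<iota> ((- 1 / 2) ^ (n - 1))"
proof -
  obtain m' n' where "m = Suc m'" "n = Suc n'" using assms by (meson gr0_implies_Suc)
  then show ?thesis by (simp add: power_add flip: iota_simps iota_minus)
qed

lemma scaled_root_sum:
  assumes b: "\<And>x y z. b (x + y) z = b x z + b y z" "\<And>x y z. b x (y + z) = b x y + b x z"
    "\<And>c x y. b (scale c x) y = scale c (b x y)" "\<And>c x y. b x (scale c y) = scale c (b x y)"
  shows "scale (\<iota> ((- 1 / 2) ^ (length l - 1)))
      (perm_sum (split_sum (\<lambda>A B. signed (len A + (1 - len B) * deg A)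
        (b (tree_sum scale (\<lambda>x y. \<eta> (br x y)) A) (tree_sum scale (\<lambda>x y. \<eta> (br x y)) B)))) l) =
    - half (unshuffle_sum (\<lambda>A B. signed (split_sign A B) (b (Phi A) (Phi B))) l)"
proof -
  let ?T = "tree_sum scale (\<lambda>x y. \<eta> (br x y))"
  have b0: "b 0 y = 0" "b x 0 = 0" for x y
    using b(3)[of 0 0 y] b(4)[of x 0 0] by simp_all
  have T0: "?T [] = 0" by (simp add: tree_sum_def Ot_0)
  have "scale (\<iota> ((- 1 / 2) ^ (length l - 1))) (signed (split_sign A B) (b (perm_sum ?T A) (perm_sum ?T B))) =
     - half (signed (split_sign A B) (b (Phi A) (Phi B)))" if AB: "mset A + mset B = mset l" for A B
  proof (cases "A = [] \<or> B = []")
    case True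
    then show ?thesis by (auto simp: T0 b0 Phi_Nil half_simps)
  next
    case False
    then show ?thesis
      unfolding unshuffle_parts(4)[OF AB]
      by (subst coefficient_product) (simp_all add: Phi_def b half_def signed_scale mult_ac)
  qed
  note * = this
  have "- half (unshuffle_sum (\<lambda>A B. signed (split_sign A B) (b (Phi A) (Phi B))) l) =
    unshuffle_sum (\<lambda>A B. - half (signed (split_sign A B) (b (Phi A) (Phi B)))) l"
    by (rule unshuffle_sum_additive) (simp add: half_simps)
  also have "\<dots> = unshuffle_sum (\<lambda>A B. scale (\<iota> ((- 1 / 2) ^ (length l - 1)))
      (signed (split_sign A B) (b (perm_sum ?T A) (perm_sum ?T B)))) l"
    by (rule unshuffle_sum_cong) (rule *[symmetric])
  also have "\<dots> = scale (\<iota> ((- 1 / 2) ^ (length l - 1)))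
      (unshuffle_sum (\<lambda>A B. signed (split_sign A B) (b (perm_sum ?T A) (perm_sum ?T B))) l)"
    by (rule unshuffle_sum_additive[symmetric]) (rule scale_right_distrib)
  finally show ?thesis
    by (simp add: perm_sum_split_sum perm_sum_bilinear[OF b(1,2)] flip: split_sign_def)
qed

text \<open>The fixed point equation \<open>\<Phi> = inclusion - \<onehalf> \<eta>[\<Phi>,\<Phi>]\<close>.\<close>

lemma Phi_rec: "Phi l = (case l of [x] \<Rightarrow> snd x | _ \<Rightarrow> 0) - half (\<eta> (Br l))"
proof -
  have "perm_sum (\<lambda>l. case l of [x] \<Rightarrow> snd x | _ \<Rightarrow> 0) l = (case l of [x] \<Rightarrow> snd x | _ \<Rightarrow> (0 :: 'a))" for l :: "(int \<times> 'a) list"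
  proof -
    consider "l = []" | x where "l = [x]" | "length l \<ge> 2"
      by (cases l; cases "tl l") auto
    then show ?thesis
    proof cases
      case 3
      have 0: "(case m of [x] \<Rightarrow> snd x | _ \<Rightarrow> 0) = (0 :: 'a)" if "length m \<ge> 2" for m :: "(int \<times> 'a) list"
        using that by (auto split: list.split)
      have "perm_sum (\<lambda>l. case l of [x] \<Rightarrow> snd x | _ \<Rightarrow> 0) l = perm_sum (\<lambda>l. 0 :: 'a) l"
        using 3 by (intro perm_sum_cong) (metis 0 mset_eq_length)
      then show ?thesis using 3 by (simp add: 0)
    qed simp_all
  qed
  note * = this
  have **: "scale (\<iota> ((- 1 / 2) ^ (length l - 1))) (case l of [x] \<Rightarrow> snd x | _ \<Rightarrow> 0) = (case l of [x] \<Rightarrow> snd x | _ \<Rightarrow> 0)"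
    by (auto split: list.split simp: iota_simps)
  let ?b = "\<lambda>x y. \<eta> (br x y)"
  let ?T = "tree_sum scale ?b"
  have eq: "?T = (\<lambda>l. (case l of [x] \<Rightarrow> snd x | _ \<Rightarrow> 0) +
    split_sum (\<lambda>A B. signed (len A + (1 - len B) * deg A) (?b (?T A) (?T B))) l)"
    by (rule ext, rule tree_sum_rec) (simp_all add: hom_simps)
  have eq2: "perm_sum ?T l = (case l of [x] \<Rightarrow> snd x | _ \<Rightarrow> 0) +
    perm_sum (split_sum (\<lambda>A B. signed (len A + (1 - len B) * deg A) (?b (?T A) (?T B)))) l"
    using arg_cong[OF eq, of "\<lambda>f. perm_sum f l"] unfolding perm_sum_add * .
  have "Phi l = (case l of [x] \<Rightarrow> snd x | _ \<Rightarrow> 0) -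
    half (unshuffle_sum (\<lambda>A B. signed (split_sign A B) (?b (Phi A) (Phi B))) l)"
    unfolding Phi_def[of l] eq2 scale_right_distrib **
    by (subst scaled_root_sum[of ?b]) (simp_all add: hom_simps)
  moreover have "\<eta> (Br l) = unshuffle_sum (\<lambda>A B. signed (split_sign A B) (?b (Phi A) (Phi B))) l"
    unfolding left_br_def
    by (subst unshuffle_sum_additive[of \<eta>]) (simp_all add: hom_simps hom_signed)
  ultimately show ?thesis by simp
qed

definition homogeneous :: "(int \<times> 'a) list \<Rightarrow> bool" where
  "homogeneous l \<longleftrightarrow> (\<forall>(p, x) \<in> set l. x \<in> G p)"

lemma homogeneous_simps: "homogeneous []" "homogeneous (z # l) \<longleftrightarrow> snd z \<in> G (fst z) \<and> homogeneous l"
  by (auto simp: homogeneous_def)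

lemma homogeneous_parts:
  "homogeneous l \<Longrightarrow> mset A + mset B = mset l \<Longrightarrow> homogeneous A \<and> homogeneous B"
  using unshuffle_parts(3)[of A B l] by (auto simp: homogeneous_def)

text \<open>The degree of \<open>Phi l\<close>.\<close>

definition shifted_deg :: "(int \<times> 'a) list \<Rightarrow> int" where
  "shifted_deg l = deg l + 1 - len l"

lemma left_br_degree:
  assumes "\<And>A B. mset A + mset B = mset l \<Longrightarrow> X A \<in> G (shifted_deg A + s) \<and> Phi B \<in> G (shifted_deg B)"
  shows "left_br X l \<in> G (shifted_deg l + 1 + s)"
  unfolding left_br_def
proof (rule unshuffle_sum_mem)
  fix A B assume AB: "mset A + mset B = mset l"
  have "br (X A) (Phi B) \<in> G (shifted_deg A + s + shifted_deg B)"
    using assms[OF AB] by (auto intro: br_degree)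
  also have "shifted_deg A + s + shifted_deg B = shifted_deg l + 1 + s"
    using unshuffle_parts(1,2)[OF AB] by (simp add: shifted_deg_def)
  finally show "signed (split_sign A B) (br (X A) (Phi B)) \<in> G (shifted_deg l + 1 + s)"
    by (rule degree_simps)
qed (simp_all add: degree_simps)

text \<open>As \<open>\<Phi>\<close> vanishes on the empty list, \<open>[X,\<Phi>]\<close> depends on \<open>X\<close> only through shorter lists. This makes
  equations such as \<open>X = \<mu> + \<eta>[X,\<Phi>]\<close> uniquely solvable.\<close>

lemma left_br_cong:
  assumes "\<And>A. length A < length l \<Longrightarrow> set A \<subseteq> set l \<Longrightarrow> X A = Y A"
  shows "left_br X l = left_br Y l"
  unfolding left_br_def
proof (rule unshuffle_sum_cong)
  fix A B assume AB: "mset A + mset B = mset l"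
  show "signed (split_sign A B) (br (X A) (Phi B)) = signed (split_sign A B) (br (Y A) (Phi B))"
  proof (cases "B = []")
    case False
    then have "X A = Y A" using unshuffle_parts(3,4)[OF AB] by (intro assms) auto
    then show ?thesis by simp
  qed (simp add: Phi_Nil hom_simps)
qed

lemma Phi_degree: "homogeneous l \<Longrightarrow> Phi l \<in> G (shifted_deg l)"
proof (induction "length l" arbitrary: l rule: less_induct)
  case less
  have Br: "Br l \<in> G (shifted_deg l + 1)"
    unfolding left_br_def
  proof (rule unshuffle_sum_mem)
    fix A B assume AB: "mset A + mset B = mset l"
    show "signed (split_sign A B) (br (Phi A) (Phi B)) \<in> G (shifted_deg l + 1)"
    proof (cases "A = [] \<or> B = []")
      case True
      then show ?thesis by (auto simp: Phi_Nil hom_simps degree_simps)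
    next
      case False
      then have "br (Phi A) (Phi B) \<in> G (shifted_deg A + shifted_deg B)"
        using homogeneous_parts[OF less.prems AB] unshuffle_parts(4)[OF AB]
        by (intro br_degree less.hyps) auto
      also have "shifted_deg A + shifted_deg B = shifted_deg l + 1" using unshuffle_parts(1,2)[OF AB] by (simp add: shifted_deg_def)
      finally show ?thesis by (rule degree_simps)
    qed
  qed (simp_all add: degree_simps)
  have "(case l of [x] \<Rightarrow> snd x | _ \<Rightarrow> 0) \<in> G (shifted_deg l)"
    using less.prems by (auto split: list.split simp: degree_simps homogeneous_def shifted_deg_def)
  then show ?case
    unfolding Phi_rec[of l] half_def using eta_degree[OF Br] by (simp add: degree_simps)
qed

lemma Br_degree: "homogeneous l \<Longrightarrow> Br l \<in> G (shifted_deg l + 1)"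
  by (rule left_br_degree[of l Phi 0, unfolded add_0_right]) (blast dest: homogeneous_parts intro: Phi_degree)

lemma mu_degree: "homogeneous l \<Longrightarrow> mu l \<in> G (shifted_deg l + 1)"
  unfolding mu_def half_def by (intro degree_simps proj_degree Br_degree)

lemma mu_harmonic: "mu l \<in> harmonic d \<eta>"
  unfolding mu_def harmonic_iff by (simp add: hom_simps half_simps d_proj eta_proj)

text \<open>The sign of interchanging the arguments, the exponent of the cut and the antisymmetry of the
  bracket combine to a bracket that is symmetric on maps of the degree of \<open>\<Phi>\<close>; \<open>s\<close> and \<open>t\<close> measure
  how much the degrees of \<open>x\<close> and \<open>y\<close> exceed it.\<close>

lemma br_swap:
  assumes "x \<in> G (shifted_deg A + s)" "y \<in> G (shifted_deg B + t)"
  shows "signed (len A * len B + deg A * deg B) (signed (split_sign B A) (br y x)) =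
    signed (split_sign A B + s * shifted_deg B + t * shifted_deg A + s * t) (br x y)"
proof -
  have "br y x = - signed ((shifted_deg B + t) * (shifted_deg A + s)) (br x y)"
    using br_antisym[OF assms(2,1)] by (simp add: scale_msign)
  also have "\<dots> = signed (1 + (shifted_deg B + t) * (shifted_deg A + s)) (br x y)"
    by (simp add: signed_Suc)
  finally show ?thesis
    by (simp only: signed_signed) (rule signed_cong, cases "even (length A)"; cases "even (length B)";
      cases "even (deg A)"; cases "even (deg B)"; cases "even s"; cases "even t";
      simp add: split_sign_def shifted_deg_def)
qed

text \<open>By the Leibniz rule \<open>d[\<Phi>,\<Phi>]\<close> has two terms, and symmetry of the bracket identifies them.\<close>

lemma d_Br:
  assumes l: "homogeneous l"
  shows "d (Br l) = left_br (\<lambda>A. d (Phi A)) l + left_br (\<lambda>A. d (Phi A)) l"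
proof -
  have "d (Br l) = unshuffle_sum (\<lambda>A B. d (signed (split_sign A B) (br (Phi A) (Phi B)))) l"
    unfolding left_br_def by (rule unshuffle_sum_additive) (rule hom_simps)
  also have "\<dots> = unshuffle_sum (\<lambda>A B. signed (split_sign A B) (br (d (Phi A)) (Phi B)) +
      signed (split_sign A B + shifted_deg A) (br (Phi A) (d (Phi B)))) l"
    by (rule unshuffle_sum_cong)
      (use homogeneous_parts[OF l] in \<open>simp add: hom_signed leibniz[OF Phi_degree Phi_degree] scale_msign signed_add signed_signed\<close>)
  also have "\<dots> = left_br (\<lambda>A. d (Phi A)) l +
      unshuffle_sum (\<lambda>A B. signed (split_sign A B + shifted_deg A) (br (Phi A) (d (Phi B)))) l"
    by (simp add: unshuffle_sum_add left_br_def)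
  also have "unshuffle_sum (\<lambda>A B. signed (split_sign A B + shifted_deg A) (br (Phi A) (d (Phi B)))) l =
    left_br (\<lambda>A. d (Phi A)) l"
    unfolding left_br_def
  proof (subst unshuffle_sum_cocomm, rule unshuffle_sum_cong)
    fix A B assume AB: "mset A + mset B = mset l"
    have "d (Phi A) \<in> G (shifted_deg A + 1)" "Phi B \<in> G (shifted_deg B + 0)"
      using homogeneous_parts[OF l AB] by (auto intro: d_degree Phi_degree)
    note swap = br_swap[OF this]
    have "signed (len A * len B + deg A * deg B) (signed (split_sign B A + shifted_deg B) (br (Phi B) (d (Phi A)))) =
      signed (shifted_deg B) (signed (len A * len B + deg A * deg B) (signed (split_sign B A) (br (Phi B) (d (Phi A)))))"
      by (simp add: signed_signed ac_simps)
    also have "\<dots> = signed (split_sign A B) (br (d (Phi A)) (Phi B))"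
      unfolding swap unfolding signed_signed by (rule signed_cong) simp
    finally show "signed (len A * len B + deg A * deg B) (signed (split_sign B A + shifted_deg B) (br (Phi B) (d (Phi A)))) =
      signed (split_sign A B) (br (d (Phi A)) (Phi B))" .
  qed
  finally show ?thesis .
qed

text \<open>\<open>[[\<Phi>,\<Phi>],\<Phi>] = 0\<close>. The Jacobi identity writes this element as twice \<open>[\<Phi>,[\<Phi>,\<Phi>]]\<close>, and by
  symmetry \<open>[\<Phi>,[\<Phi>,\<Phi>]]\<close> is the negative of the element. So three times the element vanishes.\<close>

lemma left_br_Br:
  assumes l: "homogeneous l"
  shows "left_br Br l = 0"
proof -
  \<comment> \<open>the exponent of \<open>[[\<Phi>(A),\<Phi>(B)],\<Phi>(C)]\<close>, from cutting first \<open>A @ B\<close> against \<open>C\<close> and then \<open>A\<close> against \<open>B\<close>\<close>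
  define v where "v = (\<lambda>A B C :: (int \<times> 'a) list. len A + len B + (1 - len C) * (deg A + deg B) + split_sign A B)"
  define W where "W = unshuffle_sum (\<lambda>D C. unshuffle_sum (\<lambda>A B.
     signed (v A B C) (br (Phi A) (br (Phi B) (Phi C)))) D) l"
  have "left_br Br l = unshuffle_sum (\<lambda>D C. unshuffle_sum (\<lambda>A B.
     signed (v A B C) (br (br (Phi A) (Phi B)) (Phi C))) D) l"
    unfolding left_br_def[of _ l]
  proof (rule unshuffle_sum_cong)
    fix D C assume "mset D + mset C = mset l"
    have "signed (split_sign D C) (br (Br D) (Phi C)) =
      unshuffle_sum (\<lambda>A B. signed (split_sign D C) (br (signed (split_sign A B) (br (Phi A) (Phi B))) (Phi C))) D"
      unfolding left_br_def
      by (rule unshuffle_sum_additive[of "\<lambda>x. signed (split_sign D C) (br x (Phi C))"])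
        (simp add: hom_simps signed_add)
    also have "\<dots> = unshuffle_sum (\<lambda>A B. signed (v A B C) (br (br (Phi A) (Phi B)) (Phi C))) D"
      by (rule unshuffle_sum_cong)
        (auto simp: hom_signed signed_signed v_def split_sign_def unshuffle_parts)
    finally show "signed (split_sign D C) (br (Br D) (Phi C)) =
      unshuffle_sum (\<lambda>A B. signed (v A B C) (br (br (Phi A) (Phi B)) (Phi C))) D" .
  qed
  also have "\<dots> = unshuffle_sum (\<lambda>D C. unshuffle_sum (\<lambda>A B. signed (v A B C) (br (Phi A) (br (Phi B) (Phi C)))) D +
      unshuffle_sum (\<lambda>A B. signed (v A B C) (br (Phi A) (br (Phi B) (Phi C)))) D) l"
  proof (rule unshuffle_sum_cong)
    fix D C assume "mset D + mset C = mset l"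
    then have DC: "homogeneous D" "homogeneous C" using homogeneous_parts[OF l] by auto
    have "unshuffle_sum (\<lambda>A B. signed (v A B C) (br (br (Phi A) (Phi B)) (Phi C))) D =
      unshuffle_sum (\<lambda>A B. signed (v A B C) (br (Phi A) (br (Phi B) (Phi C))) +
        signed (1 + v A B C + shifted_deg A * shifted_deg B) (br (Phi B) (br (Phi A) (Phi C)))) D"
    proof (rule unshuffle_sum_cong)
      fix A B assume "mset A + mset B = mset D"
      then have AB: "homogeneous A" "homogeneous B" using homogeneous_parts[OF DC(1)] by auto
      have "br (br (Phi A) (Phi B)) (Phi C) = br (Phi A) (br (Phi B) (Phi C)) +
         signed (1 + shifted_deg A * shifted_deg B) (br (Phi B) (br (Phi A) (Phi C)))"
        using jacobi[OF Phi_degree[OF AB(1)] Phi_degree[OF AB(2)] Phi_degree[OF DC(2)]]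
        by (simp add: scale_msign signed_Suc)
      then show "signed (v A B C) (br (br (Phi A) (Phi B)) (Phi C)) = signed (v A B C) (br (Phi A) (br (Phi B) (Phi C))) +
        signed (1 + v A B C + shifted_deg A * shifted_deg B) (br (Phi B) (br (Phi A) (Phi C)))"
        by (simp add: signed_add signed_signed ac_simps)
    qed
    also have "\<dots> = unshuffle_sum (\<lambda>A B. signed (v A B C) (br (Phi A) (br (Phi B) (Phi C)))) D +
        unshuffle_sum (\<lambda>A B. signed (1 + v A B C + shifted_deg A * shifted_deg B) (br (Phi B) (br (Phi A) (Phi C)))) D"
      by (rule unshuffle_sum_add)
    also have "unshuffle_sum (\<lambda>A B. signed (1 + v A B C + shifted_deg A * shifted_deg B) (br (Phi B) (br (Phi A) (Phi C)))) D =
       unshuffle_sum (\<lambda>A B. signed (v A B C) (br (Phi A) (br (Phi B) (Phi C)))) D"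
    proof (subst unshuffle_sum_cocomm, rule unshuffle_sum_cong)
      fix A B :: "(int \<times> 'a) list"
      show "signed (len A * len B + deg A * deg B)
          (signed (1 + v B A C + shifted_deg B * shifted_deg A) (br (Phi A) (br (Phi B) (Phi C)))) =
        signed (v A B C) (br (Phi A) (br (Phi B) (Phi C)))"
        unfolding signed_signed
        by (rule signed_cong, cases "even (length A)"; cases "even (length B)";
          cases "even (deg A)"; cases "even (deg B)"; simp add: v_def split_sign_def shifted_deg_def)
    qed
    finally show "unshuffle_sum (\<lambda>A B. signed (v A B C) (br (br (Phi A) (Phi B)) (Phi C))) D =
      unshuffle_sum (\<lambda>A B. signed (v A B C) (br (Phi A) (br (Phi B) (Phi C)))) D +
      unshuffle_sum (\<lambda>A B. signed (v A B C) (br (Phi A) (br (Phi B) (Phi C)))) D" .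
  qed
  also have "\<dots> = W + W" by (simp add: unshuffle_sum_add W_def)
  \<comment> \<open>\<open>W\<close> is \<open>[\<Phi>,[\<Phi>,\<Phi>]]\<close>; the two terms of the Jacobi identity agree after interchanging \<open>A\<close> and \<open>B\<close>\<close>
  finally have 1: "left_br Br l = W + W" .
  have "W = unshuffle_sum (\<lambda>A D. unshuffle_sum (\<lambda>B C.
     signed (v A B C) (br (Phi A) (br (Phi B) (Phi C)))) D) l"
    unfolding W_def by (rule unshuffle_sum_coassoc)
  also have "\<dots> = unshuffle_sum (\<lambda>A D. signed (split_sign A D + shifted_deg A + 1) (br (Phi A) (Br D))) l"
  proof (rule unshuffle_sum_cong)
    fix A D assume "mset A + mset D = mset l"
    have "signed (split_sign A D + shifted_deg A + 1) (br (Phi A) (Br D)) =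
      unshuffle_sum (\<lambda>B C. signed (split_sign A D + shifted_deg A + 1) (br (Phi A) (signed (split_sign B C) (br (Phi B) (Phi C))))) D"
      unfolding left_br_def
      by (rule unshuffle_sum_additive[of "\<lambda>x. signed (split_sign A D + shifted_deg A + 1) (br (Phi A) x)"])
        (simp add: hom_simps signed_add)
    also have "\<dots> = unshuffle_sum (\<lambda>B C. signed (v A B C) (br (Phi A) (br (Phi B) (Phi C)))) D"
    proof (rule unshuffle_sum_cong)
      fix B C assume BC: "mset B + mset C = mset D"
      show "signed (split_sign A D + shifted_deg A + 1) (br (Phi A) (signed (split_sign B C) (br (Phi B) (Phi C)))) =
        signed (v A B C) (br (Phi A) (br (Phi B) (Phi C)))"
        unfolding hom_signed signed_signed v_def split_sign_def shifted_deg_def unshuffle_parts(1,2)[OF BC]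
        by (rule signed_cong, cases "even (length A)"; cases "even (length B)"; cases "even (length C)";
          cases "even (deg A)"; cases "even (deg B)"; simp)
    qed
    finally show "unshuffle_sum (\<lambda>B C. signed (v A B C) (br (Phi A) (br (Phi B) (Phi C)))) D =
      signed (split_sign A D + shifted_deg A + 1) (br (Phi A) (Br D))" by simp
  qed
  also have "\<dots> = unshuffle_sum (\<lambda>A D. - signed (split_sign A D) (br (Br A) (Phi D))) l"
  proof (subst unshuffle_sum_cocomm, rule unshuffle_sum_cong)
    fix A B assume AB: "mset A + mset B = mset l"
    have "Br A \<in> G (shifted_deg A + 1)" "Phi B \<in> G (shifted_deg B + 0)"
      using homogeneous_parts[OF l AB] by (auto intro: Br_degree Phi_degree)
    note swap = br_swap[OF this]
    have "signed (len A * len B + deg A * deg B) (signed (split_sign B A + shifted_deg B + 1) (br (Phi B) (Br A))) =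
      signed (1 + shifted_deg B) (signed (len A * len B + deg A * deg B) (signed (split_sign B A) (br (Phi B) (Br A))))"
      by (simp add: signed_signed ac_simps)
    also have "\<dots> = signed (1 + split_sign A B) (br (Br A) (Phi B))"
      unfolding swap unfolding signed_signed by (rule signed_cong) simp
    finally show "signed (len A * len B + deg A * deg B) (signed (split_sign B A + shifted_deg B + 1) (br (Phi B) (Br A))) =
      - signed (split_sign A B) (br (Br A) (Phi B))"
      by (simp add: signed_Suc)
  qed
  also have "\<dots> = - left_br Br l"
    by (simp add: left_br_def[of _ l] minus_unshuffle_sum)
  finally have "W = - left_br Br l" .
  then have "left_br Br l = - (left_br Br l + left_br Br l)" using 1 by simp
  then have "left_br Br l + left_br Br l + left_br Br l = 0"
    unfolding eq_neg_iff_add_eq_0 by (simp only: add.assoc)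
  then show ?thesis by (rule triple_eq_0)
qed

end

section \<open>The curvature and the L-infinity relations\<close>

context dg_lie_contraction
begin

definition harmonic_list :: "(int \<times> 'a) list \<Rightarrow> bool" where
  "harmonic_list l \<longleftrightarrow> homogeneous l \<and> snd ` set l \<subseteq> harmonic d \<eta>"

lemma left_br_add: "left_br (\<lambda>A. X A + Y A) l = left_br X l + left_br Y l"
  unfolding left_br_def by (simp add: hom_simps signed_add unshuffle_sum_add)

lemma left_br_minus: "left_br (\<lambda>A. - X A) l = - left_br X l"
  unfolding left_br_def by (simp add: hom_simps signed_minus minus_unshuffle_sum)

lemma left_br_half: "left_br (\<lambda>A. half (X A)) l = half (left_br X l)"
  unfolding left_br_def
  by (subst unshuffle_sum_additive[of half]) (simp_all add: half_simps)

text \<open>The failure of \<open>\<Phi>\<close> to satisfy the Maurer-Cartan equation, up to sign.\<close>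

definition curvature :: "(int \<times> 'a) list \<Rightarrow> 'a" where
  "curvature l = - (d (Phi l) + half (Br l))"

text \<open>\<open>[d\<Phi>,\<Phi>]\<close> is half of \<open>d[\<Phi>,\<Phi>]\<close>, and the quadratic part of the curvature does not contribute by
  the Jacobi identity.\<close>

lemma left_br_curvature:
  assumes "homogeneous l"
  shows "left_br curvature l = - half (d (Br l))"
proof -
  have "left_br curvature l = - (left_br (\<lambda>A. d (Phi A)) l + half (left_br Br l))"
    unfolding curvature_def by (simp only: left_br_minus left_br_add left_br_half)
  also have "\<dots> = - left_br (\<lambda>A. d (Phi A)) l"
    using left_br_Br[OF assms] by (simp add: half_simps)
  also have "\<dots> = - half (d (Br l))"
    by (simp add: d_Br[OF assms] half_double)
  finally show ?thesis .
qed

text \<open>The inclusion of harmonic elements is annihilated by \<open>d\<close>, so the fixed point equation gives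
  \<open>d\<Phi> = - \<onehalf> d\<eta>[\<Phi>,\<Phi>]\<close>; then use \<open>1 - d \<eta> = proj + \<eta> d\<close>.\<close>

lemma curvature_rec:
  assumes "harmonic_list l"
  shows "curvature l = mu l + \<eta> (left_br curvature l)"
proof -
  have "d (case l of [x] \<Rightarrow> snd x | _ \<Rightarrow> 0) = 0"
    using assms by (auto split: list.split simp: hom_simps harmonic_list_def harmonic_iff)
  then have "d (Phi l) = - half (d (\<eta> (Br l)))"
    by (simp add: Phi_rec[of l] hom_simps half_simps)
  moreover have "Br l = proj (Br l) + d (\<eta> (Br l)) + \<eta> (d (Br l))"
    by (simp add: proj_def comm_d_eta_def)
  then have "half (Br l) = half (proj (Br l)) + half (d (\<eta> (Br l))) + half (\<eta> (d (Br l)))"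
    by (metis half_simps(1))
  ultimately have "curvature l = - half (proj (Br l)) - half (\<eta> (d (Br l)))"
    by (simp add: curvature_def)
  then show ?thesis
    using assms by (simp add: mu_def left_br_curvature harmonic_list_def hom_simps half_simps)
qed

text \<open>The value of a transferred bracket as a new entry of a list.\<close>

definition mu_arg :: "(int \<times> 'a) list \<Rightarrow> int \<times> 'a" where
  "mu_arg A = (shifted_deg A + 1, mu A)"

lemma mu_arg_degree: "homogeneous A \<Longrightarrow> snd (mu_arg A) \<in> G (fst (mu_arg A))"
  by (simp add: mu_arg_def mu_degree)

text \<open>The first entry is in the left or in the right part, and symmetry identifies the two cases.\<close>

lemma Br_Cons:
  assumes "homogeneous (z # l)"
  shows "Br (z # l) =
    unshuffle_sum (\<lambda>A B. signed (split_sign (z # A) B) (br (Phi (z # A)) (Phi B))) l +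
    unshuffle_sum (\<lambda>A B. signed (split_sign (z # A) B) (br (Phi (z # A)) (Phi B))) l"
proof -
  have "unshuffle_sum (\<lambda>A B. signed (len A + fst z * deg A)
      (signed (split_sign A (z # B)) (br (Phi A) (Phi (z # B))))) l =
    unshuffle_sum (\<lambda>A B. signed (split_sign (z # A) B) (br (Phi (z # A)) (Phi B))) l"
  proof (subst unshuffle_sum_cocomm, rule unshuffle_sum_cong)
    fix A B assume AB: "mset A + mset B = mset l"
    then have "Phi (z # A) \<in> G (shifted_deg (z # A) + 0)" "Phi B \<in> G (shifted_deg B + 0)"
      using assms homogeneous_parts[of l A B] by (auto simp: homogeneous_simps intro!: Phi_degree)
    note swap = br_swap[OF this]
    have "signed (len A * len B + deg A * deg B) (signed (len B + fst z * deg B)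
        (signed (split_sign B (z # A)) (br (Phi B) (Phi (z # A))))) =
      signed (len (z # A) * len B + deg (z # A) * deg B)
        (signed (split_sign B (z # A)) (br (Phi B) (Phi (z # A))))"
      by (simp add: signed_signed algebra_simps)
    also have "\<dots> = signed (split_sign (z # A) B) (br (Phi (z # A)) (Phi B))"
      unfolding swap by simp
    finally show "signed (len A * len B + deg A * deg B) (signed (len B + fst z * deg B)
        (signed (split_sign B (z # A)) (br (Phi B) (Phi (z # A))))) =
      signed (split_sign (z # A) B) (br (Phi (z # A)) (Phi B))" .
  qed
  then show ?thesis by (simp add: left_br_def)
qed

text \<open>The derivative of \<open>\<Phi>\<close> in the direction of \<open>\<mu>\<close>: a bracket of some of the arguments is inserted
  into \<open>\<Phi>\<close>, with the sign of the L-infinity relation, as there are \<open>k\<close> entries in \<open>A\<close> and \<open>l - 1\<close>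
  entries in \<open>B\<close>.\<close>

definition Phi_along_mu :: "(int \<times> 'a) list \<Rightarrow> 'a" where
  "Phi_along_mu l = unshuffle_sum (\<lambda>A B. signed (len A * len B) (Phi (mu_arg A # B))) l"

text \<open>The derivative of the quadratic map \<open>\<onehalf>[\<Phi>,\<Phi>]\<close>. By coassociativity it does not matter whether the
  arguments of \<open>\<mu>\<close> are split off first, or the list is first cut at the bracket.\<close>

lemma Br_along_mu:
  assumes l: "homogeneous l"
  shows "unshuffle_sum (\<lambda>A B. signed (len A * len B) (half (Br (mu_arg A # B)))) l =
    - left_br Phi_along_mu l"
proof -
  define k where "k = (\<lambda>A B C. signed (len A * (len B + len C))
    (signed (split_sign (mu_arg A # B) C) (br (Phi (mu_arg A # B)) (Phi C))))"
  have "unshuffle_sum (\<lambda>A B. signed (len A * len B) (half (Br (mu_arg A # B)))) l =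
    unshuffle_sum (\<lambda>A D. unshuffle_sum (\<lambda>B C. k A B C) D) l"
  proof (rule unshuffle_sum_cong)
    fix A D assume AD: "mset A + mset D = mset l"
    have "homogeneous (mu_arg A # D)"
      using homogeneous_parts[OF l AD] mu_arg_degree[of A] by (simp add: homogeneous_simps)
    then have "half (Br (mu_arg A # D)) = unshuffle_sum (\<lambda>B C.
        signed (split_sign (mu_arg A # B) C) (br (Phi (mu_arg A # B)) (Phi C))) D"
      by (simp add: Br_Cons half_double)
    then have "signed (len A * len D) (half (Br (mu_arg A # D))) = unshuffle_sum (\<lambda>B C.
        signed (len A * len D) (signed (split_sign (mu_arg A # B) C) (br (Phi (mu_arg A # B)) (Phi C)))) D"
      by (simp only: signed_unshuffle_sum)
    also have "\<dots> = unshuffle_sum (\<lambda>B C. k A B C) D"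
      by (rule unshuffle_sum_cong) (simp add: k_def unshuffle_parts(1))
    finally show "signed (len A * len D) (half (Br (mu_arg A # D))) = unshuffle_sum (\<lambda>B C. k A B C) D" .
  qed
  also have "\<dots> = unshuffle_sum (\<lambda>D C. unshuffle_sum (\<lambda>A B. k A B C) D) l"
    by (rule unshuffle_sum_coassoc[symmetric])
  also have "\<dots> = unshuffle_sum (\<lambda>D C. - signed (split_sign D C) (br (Phi_along_mu D) (Phi C))) l"
  proof (rule unshuffle_sum_cong)
    fix D C
    have "- signed (split_sign D C) (br (Phi_along_mu D) (Phi C)) =
      unshuffle_sum (\<lambda>A B. - signed (split_sign D C) (br (signed (len A * len B) (Phi (mu_arg A # B))) (Phi C))) D"
      unfolding Phi_along_mu_def
      by (rule unshuffle_sum_additive[of "\<lambda>x. - signed (split_sign D C) (br x (Phi C))"])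
        (simp add: hom_simps signed_add)
    also have "\<dots> = unshuffle_sum (\<lambda>A B. k A B C) D"
    proof (rule unshuffle_sum_cong)
      fix A B assume AB: "mset A + mset B = mset D"
      have "- signed (split_sign D C) (br (signed (len A * len B) (Phi (mu_arg A # B))) (Phi C)) =
        signed (1 + split_sign D C + len A * len B) (br (Phi (mu_arg A # B)) (Phi C))"
        by (simp add: hom_signed signed_signed add.assoc flip: signed_Suc(2))
      also have "\<dots> = k A B C"
        unfolding k_def signed_signed mu_arg_def shifted_deg_def split_sign_def unshuffle_parts(1,2)[OF AB]
        by (rule signed_cong, cases "even (length A)"; cases "even (length B)"; cases "even (length C)";
            cases "even (deg A)"; cases "even (deg B)"; simp)
      finally show "- signed (split_sign D C) (br (signed (len A * len B) (Phi (mu_arg A # B))) (Phi C)) = k A B C" .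
    qed
    finally show "unshuffle_sum (\<lambda>A B. k A B C) D = - signed (split_sign D C) (br (Phi_along_mu D) (Phi C))" ..
  qed
  also have "\<dots> = - left_br Phi_along_mu l"
    by (simp add: left_br_def[of _ l] minus_unshuffle_sum)
  finally show ?thesis .
qed

lemma Phi_along_mu_rec:
  assumes l: "homogeneous l"
  shows "Phi_along_mu l = mu l + \<eta> (left_br Phi_along_mu l)"
proof -
  have "Phi_along_mu l = unshuffle_sum (\<lambda>A B. (if B = [] then mu A else 0) +
     - \<eta> (signed (len A * len B) (half (Br (mu_arg A # B))))) l"
    unfolding Phi_along_mu_def
  proof (rule unshuffle_sum_cong)
    fix A B :: "(int \<times> 'a) list"
    have "signed (len A * len B) (case mu_arg A # B of [x] \<Rightarrow> snd x | _ \<Rightarrow> 0) = (if B = [] then mu A else 0)"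
      by (auto simp: mu_arg_def split: list.split)
    then show "signed (len A * len B) (Phi (mu_arg A # B)) = (if B = [] then mu A else 0) +
     - \<eta> (signed (len A * len B) (half (Br (mu_arg A # B))))"
      unfolding Phi_rec[of "mu_arg A # B"] diff_conv_add_uminus signed_add
      by (simp only: signed_minus hom_signed half_simps)
  qed
  also have "\<dots> = mu l + unshuffle_sum (\<lambda>A B. - \<eta> (signed (len A * len B) (half (Br (mu_arg A # B))))) l"
    by (simp only: unshuffle_sum_add unshuffle_sum_right_empty)
  also have "unshuffle_sum (\<lambda>A B. - \<eta> (signed (len A * len B) (half (Br (mu_arg A # B))))) l =
    - \<eta> (unshuffle_sum (\<lambda>A B. signed (len A * len B) (half (Br (mu_arg A # B)))) l)"
    by (rule unshuffle_sum_additive[symmetric]) (simp add: hom_simps)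
  finally show ?thesis by (simp add: Br_along_mu[OF l] hom_simps)
qed

text \<open>Both satisfy \<open>X = \<mu> + \<eta>[X,\<Phi>]\<close>, which determines \<open>X\<close> by induction on the length.\<close>

lemma Phi_along_mu_eq_curvature: "harmonic_list l \<Longrightarrow> Phi_along_mu l = curvature l"
proof (induction "length l" arbitrary: l rule: less_induct)
  case less
  have "left_br Phi_along_mu l = left_br curvature l"
  proof (rule left_br_cong)
    fix A assume "length A < length l" "set A \<subseteq> set l"
    moreover from this have "harmonic_list A"
      using less.prems by (auto simp: harmonic_list_def homogeneous_def)
    ultimately show "Phi_along_mu A = curvature A" by (intro less.hyps)
  qed
  then show ?case
    using less.prems Phi_along_mu_rec[of l] curvature_rec[of l] by (simp add: harmonic_list_def)
qed

text \<open>The L-infinity relation is the derivative of \<open>\<mu> = - \<onehalf> proj [\<Phi>,\<Phi>]\<close> in the direction of \<open>\<mu>\<close>. It is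
  \<open>proj [X,\<Phi>]\<close> for the curvature \<open>X\<close>, and \<open>[X,\<Phi>]\<close> is a boundary, which \<open>proj\<close> annihilates.\<close>

lemma mu_relation:
  assumes l: "harmonic_list l"
  shows "unshuffle_sum (\<lambda>A B. signed (len A * len B) (mu (mu_arg A # B))) l = 0"
proof -
  have hom: "homogeneous l" using l by (simp add: harmonic_list_def)
  have "unshuffle_sum (\<lambda>A B. signed (len A * len B) (mu (mu_arg A # B))) l =
    - proj (unshuffle_sum (\<lambda>A B. signed (len A * len B) (half (Br (mu_arg A # B)))) l)"
    by (subst unshuffle_sum_additive[of "\<lambda>x. - proj x"])
      (simp_all add: mu_def proj_simps hom_signed half_simps signed_minus)
  also have "\<dots> = proj (left_br Phi_along_mu l)"
    by (simp add: Br_along_mu[OF hom] proj_simps)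
  also have "left_br Phi_along_mu l = left_br curvature l"
    using l by (intro left_br_cong Phi_along_mu_eq_curvature) (auto simp: harmonic_list_def homogeneous_def)
  also have "proj (left_br curvature l) = 0"
    by (simp add: left_br_curvature[OF hom] proj_simps half_simps proj_d)
  finally show ?thesis .
qed

lemma Phi_linear:
  "Phi (us @ (p, scale c v + w) # vs) = scale c (Phi (us @ (p, v) # vs)) + Phi (us @ (p, w) # vs)"
  and Br_linear:
  "Br (us @ (p, scale c v + w) # vs) = scale c (Br (us @ (p, v) # vs)) + Br (us @ (p, w) # vs)"
proof (induction "length us + length vs" arbitrary: us vs rule: less_induct)
  case less
  have *: "Phi (us' @ (p, scale c v + w) # vs') = scale c (Phi (us' @ (p, v) # vs')) + Phi (us' @ (p, w) # vs')"
    if "length us' + length vs' < length us + length vs" for us' vs'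
    using less that by blast
  show Br: "Br (us @ (p, scale c v + w) # vs) = scale c (Br (us @ (p, v) # vs)) + Br (us @ (p, w) # vs)"
    unfolding left_br_def
  proof (rule unshuffle_sum_linear)
    fix us' vs' B :: "(int \<times> 'a) list"
    assume len: "length us' + length vs' + length B + 1 = length us + length vs + 1"
    show "signed (split_sign (us' @ (p, scale c v + w) # vs') B) (br (Phi (us' @ (p, scale c v + w) # vs')) (Phi B)) =
       scale c (signed (split_sign (us' @ (p, v) # vs') B) (br (Phi (us' @ (p, v) # vs')) (Phi B))) +
       signed (split_sign (us' @ (p, w) # vs') B) (br (Phi (us' @ (p, w) # vs')) (Phi B))"
    proof (cases "B = []")
      case False
      then have "length us' + length vs' < length us + length vs" using len by (cases B) auto
      then show ?thesis by (simp add: * split_sign_def hom_simps signed_add signed_scale)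
    qed (simp add: Phi_Nil hom_simps)
  next
    fix us' vs' B :: "(int \<times> 'a) list"
    assume len: "length us' + length vs' + length B + 1 = length us + length vs + 1"
    show "signed (split_sign B (us' @ (p, scale c v + w) # vs')) (br (Phi B) (Phi (us' @ (p, scale c v + w) # vs'))) =
       scale c (signed (split_sign B (us' @ (p, v) # vs')) (br (Phi B) (Phi (us' @ (p, v) # vs')))) +
       signed (split_sign B (us' @ (p, w) # vs')) (br (Phi B) (Phi (us' @ (p, w) # vs')))"
    proof (cases "B = []")
      case False
      then have "length us' + length vs' < length us + length vs" using len by (cases B) auto
      then show ?thesis by (simp add: * split_sign_def hom_simps signed_add signed_scale)
    qed (simp add: Phi_Nil hom_simps)
  qed simp_all
  have "(case us @ (p, scale c v + w) # vs of [x] \<Rightarrow> snd x | _ \<Rightarrow> 0) =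
    scale c (case us @ (p, v) # vs of [x] \<Rightarrow> snd x | _ \<Rightarrow> 0) + (case us @ (p, w) # vs of [x] \<Rightarrow> snd x | _ \<Rightarrow> 0)"
    by (cases us; cases vs) (auto split: list.split)
  then show "Phi (us @ (p, scale c v + w) # vs) = scale c (Phi (us @ (p, v) # vs)) + Phi (us @ (p, w) # vs)"
    unfolding Phi_rec[of "_ @ _"] Br half_def
    by (simp add: hom_simps scale_right_distrib scale_right_diff_distrib mult.commute)
qed

lemma mu_linear:
  "mu (us @ (p, scale c v + w) # vs) = scale c (mu (us @ (p, v) # vs)) + mu (us @ (p, w) # vs)"
  unfolding mu_def Br_linear half_def by (simp add: proj_simps scale_right_distrib mult.commute)

lemma Phi_antisym:
  "Phi (us @ [a, b] @ vs) + signed (fst a * fst b) (Phi (us @ [b, a] @ vs)) = 0"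
  and Br_antisym:
  "Br (us @ [a, b] @ vs) + signed (fst a * fst b) (Br (us @ [b, a] @ vs)) = 0"
proof (induction "length us + length vs" arbitrary: us vs rule: less_induct)
  case less
  have *: "Phi (us' @ a # b # vs') = - signed (fst a * fst b) (Phi (us' @ b # a # vs'))"
    if "length us' + length vs' < length us + length vs" for us' vs'
    using less that by (simp add: eq_neg_iff_add_eq_0)
  show Br: "Br (us @ [a, b] @ vs) + signed (fst a * fst b) (Br (us @ [b, a] @ vs)) = 0"
    unfolding left_br_def
  proof (rule unshuffle_sum_antisym)
    fix us' vs' B :: "(int \<times> 'a) list"
    assume len: "length us' + length vs' + length B + 2 = length us + length vs + 2"
    show "signed (split_sign (us' @ [a, b] @ vs') B) (br (Phi (us' @ [a, b] @ vs')) (Phi B)) +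
       signed (fst a * fst b) (signed (split_sign (us' @ [b, a] @ vs') B) (br (Phi (us' @ [b, a] @ vs')) (Phi B))) = 0"
    proof (cases "B = []")
      case False
      then have "length us' + length vs' < length us + length vs" using len by (cases B) auto
      then show ?thesis
        by (simp add: * split_sign_def hom_simps hom_signed signed_minus signed_signed ac_simps)
    qed (simp add: Phi_Nil hom_simps)
  next
    fix us' vs' B :: "(int \<times> 'a) list"
    assume len: "length us' + length vs' + length B + 2 = length us + length vs + 2"
    show "signed (split_sign B (us' @ [a, b] @ vs')) (br (Phi B) (Phi (us' @ [a, b] @ vs'))) +
       signed (fst a * fst b) (signed (split_sign B (us' @ [b, a] @ vs')) (br (Phi B) (Phi (us' @ [b, a] @ vs')))) = 0"
    proof (cases "B = []")
      case False
      then have "length us' + length vs' < length us + length vs" using len by (cases B) auto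
      then show ?thesis
        by (simp add: * split_sign_def hom_simps hom_signed signed_minus signed_signed ac_simps)
    qed (simp add: Phi_Nil hom_simps)
  qed simp_all
  have "(case us @ [x, y] @ vs of [x] \<Rightarrow> snd x | _ \<Rightarrow> 0) = (0 :: 'a)" for x y
    by (auto split: list.split simp: append_eq_Cons_conv)
  then have "Phi (us @ [x, y] @ vs) = - half (\<eta> (Br (us @ [x, y] @ vs)))" for x y
    unfolding Phi_rec[of "_ @ _"] by simp
  then have "Phi (us @ [a, b] @ vs) + signed (fst a * fst b) (Phi (us @ [b, a] @ vs)) =
    - half (\<eta> (Br (us @ [a, b] @ vs) + signed (fst a * fst b) (Br (us @ [b, a] @ vs))))"
    by (simp add: hom_simps hom_signed half_simps signed_minus)
  then show "Phi (us @ [a, b] @ vs) + signed (fst a * fst b) (Phi (us @ [b, a] @ vs)) = 0"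
    unfolding Br by (simp add: hom_simps half_simps)
qed

lemma mu_antisym: "mu (us @ [a, b] @ vs) + signed (fst a * fst b) (mu (us @ [b, a] @ vs)) = 0"
proof -
  have "mu (us @ [a, b] @ vs) + signed (fst a * fst b) (mu (us @ [b, a] @ vs)) =
    - half (proj (Br (us @ [a, b] @ vs) + signed (fst a * fst b) (Br (us @ [b, a] @ vs))))"
    unfolding mu_def by (simp add: proj_simps hom_signed half_simps signed_minus)
  then show ?thesis unfolding Br_antisym by (simp add: proj_simps half_simps)
qed

lemma mu_short: "length l \<le> 1 \<Longrightarrow> mu l = 0"
  by (cases l) (auto simp: mu_def left_br_def Phi_Nil hom_simps proj_simps half_simps)

lemma mu_pair:
  assumes "x \<in> G p" "y \<in> G q"
  shows "mu [(p, x), (q, y)] = proj (br x y)"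
proof -
  have "Br [z] = 0" for z
    by (simp add: left_br_def Phi_Nil hom_simps)
  then have P: "Phi [z] = snd z" for z
    by (subst Phi_rec) (simp add: hom_simps half_simps)
  have "br y x = - signed (q * p) (br x y)"
    using br_antisym[OF assms(2,1)] by (simp add: scale_msign)
  then have "Br [(p, x), (q, y)] = - br x y + - br x y"
    by (simp add: left_br_def Phi_Nil hom_simps P split_sign_def signed_signed signed_minus)
      (auto simp: signed_def)
  then show ?thesis by (simp only: mu_def proj_simps half_double minus_minus)
qed

text \<open>Antisymmetrization commutes with the sum over trees, and all trees are cut at the root, where
  \<open>proj\<close> takes the place of \<open>\<eta>\<close>.\<close>

lemma transferred_summand_eq_mu:
  assumes "length ps = length xs" "length xs = n" "n \<ge> 2"
  shows "scale (\<iota> ((- 1 / 2) ^ (n - 1)))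
      (\<Sum>\<phi> \<in> Ot n. scale (tree_sign \<phi>) (antisymmetrize scale
         (tree_map scale (root_label (0, \<lambda>x y. br x y - comm_d_eta d \<eta> (br x y)) (-1, \<lambda>x y. \<eta> (br x y)) \<phi>)) ps xs)) =
    mu (zip ps xs)"
proof -
  let ?l = "zip ps xs" and ?b = "\<lambda>x y. proj (br x y)" and ?g = "\<lambda>x y. \<eta> (br x y)"
  have n: "length ?l = n" using assms by simp
  have "(\<Sum>\<phi> \<in> Ot n. scale (tree_sign \<phi>) (antisymmetrize scale (tree_map scale (root_label (0, ?b) (-1, ?g) \<phi>)) ps xs)) =
    perm_sum (\<lambda>l. \<Sum>\<phi>\<in>Ot n. signed (tree_weight \<phi>)
      (tree_map scale (root_label (0, ?b) (-1, ?g) \<phi>) (map fst l) (map snd l))) ?l"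
    unfolding perm_sum_sum perm_sum_signed tree_sign_weight scale_msign antisymmetrize_eq_perm_sum[OF assms(1)] ..
  also have "\<dots> = perm_sum (split_sum (\<lambda>A B. signed (len A + (1 - len B) * deg A)
      (?b (tree_sum scale ?g A) (tree_sum scale ?g B)))) ?l"
  proof (rule perm_sum_cong)
    fix m assume "mset m = mset ?l"
    then have "length m = n" using n by (metis mset_eq_length)
    with assms(3) show "(\<Sum>\<phi>\<in>Ot n. signed (tree_weight \<phi>)
      (tree_map scale (root_label (0, ?b) (-1, ?g) \<phi>) (map fst m) (map snd m))) =
      split_sum (\<lambda>A B. signed (len A + (1 - len B) * deg A) (?b (tree_sum scale ?g A) (tree_sum scale ?g B))) m"
      using root_tree_sum[of ?b m 0 ?g] by (simp add: proj_simps hom_simps)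
  qed
  finally have "scale (\<iota> ((- 1 / 2) ^ (n - 1)))
      (\<Sum>\<phi> \<in> Ot n. scale (tree_sign \<phi>) (antisymmetrize scale (tree_map scale (root_label (0, ?b) (-1, ?g) \<phi>)) ps xs)) =
    - half (unshuffle_sum (\<lambda>A B. signed (split_sign A B) (?b (Phi A) (Phi B))) ?l)"
    using scaled_root_sum[of ?b ?l] n by (simp add: proj_simps hom_simps)
  also have "\<dots> = mu ?l"
    unfolding mu_def left_br_def
    by (subst unshuffle_sum_additive[of proj]) (simp_all add: proj_simps hom_signed)
  finally show ?thesis by (simp only: proj_def)
qed

end

section \<open>Extension to inhomogeneous arguments\<close>

context graded_module
begin

lemma hcomp_decomposition:
  assumes "x \<in> M"
  shows "hcomp G x p \<in> G p" "finite {p. hcomp G x p \<noteq> 0}" "x = (\<Sum>p | hcomp G x p \<noteq> 0. hcomp G x p)"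
  using theI'[OF direct_sum[OF assms]] unfolding hcomp_def by blast+

lemma hcomp_unique:
  assumes "x \<in> M" "finite S" "\<And>p. c p \<in> G p" "\<And>p. p \<notin> S \<Longrightarrow> c p = 0" "x = (\<Sum>p\<in>S. c p)"
  shows "hcomp G x = c"
proof -
  have "x = (\<Sum>p | c p \<noteq> 0. c p)"
    unfolding assms(5) using assms(2,4) by (intro sum.mono_neutral_right) auto
  moreover have "finite {p. c p \<noteq> 0}"
    using assms(2,4) by (intro finite_subset[of "{p. c p \<noteq> 0}" S]) auto
  ultimately show ?thesis
    unfolding hcomp_def using assms(1,3) by (intro the1_equality direct_sum) auto
qed

lemma hcomp_sum_superset:
  assumes "x \<in> M" "finite S" "{p. hcomp G x p \<noteq> 0} \<subseteq> S"
  shows "x = (\<Sum>p\<in>S. hcomp G x p)"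
proof -
  have "x = (\<Sum>p | hcomp G x p \<noteq> 0. hcomp G x p)" by (rule hcomp_decomposition[OF assms(1)])
  also have "\<dots> = (\<Sum>p\<in>S. hcomp G x p)" using assms(2,3) by (intro sum.mono_neutral_left) auto
  finally show ?thesis .
qed

lemma hcomp_linear:
  assumes "x \<in> M" "y \<in> M"
  shows "hcomp G (scale c x + y) p = scale c (hcomp G x p) + hcomp G y p"
proof -
  let ?S = "{p. hcomp G x p \<noteq> 0} \<union> {p. hcomp G y p \<noteq> 0}"
  have S: "finite ?S" using hcomp_decomposition(2) assms by simp
  have "hcomp G (scale c x + y) = (\<lambda>p. scale c (hcomp G x p) + hcomp G y p)"
  proof (rule hcomp_unique[OF _ S])
    show "scale c x + y \<in> M"
      using assms subspace_carrier by (simp add: subspace_add subspace_scale)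
    show "scale c (hcomp G x p) + hcomp G y p \<in> G p" for p
      using hcomp_decomposition(1) assms subspace_degree[of p] by (simp add: subspace_add subspace_scale)
    have "x = (\<Sum>p\<in>?S. hcomp G x p)" "y = (\<Sum>p\<in>?S. hcomp G y p)"
      by (rule hcomp_sum_superset[OF _ S]; use assms in blast)+
    then show "scale c x + y = (\<Sum>p\<in>?S. scale c (hcomp G x p) + hcomp G y p)"
      by (simp only: sum.distrib scale_sum_right[symmetric])
  qed auto
  then show ?thesis by simp
qed

end

text \<open>The extension of a function of homogeneous arguments, one argument at a time. This form of
  \<open>multilinear_ext\<close> allows induction on the list of arguments.\<close>

fun component_sum ::
  "(int \<Rightarrow> 'a::ab_group_add set) \<Rightarrow> ((int \<times> 'a) list \<Rightarrow> 'a) \<Rightarrow> 'a list \<Rightarrow> 'a" where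
  "component_sum G f [] = f []"
| "component_sum G f (x # xs) =
     (\<Sum>p | hcomp G x p \<noteq> 0. component_sum G (\<lambda>l. f ((p, hcomp G x p) # l)) xs)"

lemma sum_set_Cons: "sum f (set_Cons A S) = (\<Sum>x\<in>A. \<Sum>xs\<in>S. f (x # xs))"
proof -
  have "set_Cons A S = (\<lambda>(x, xs). x # xs) ` (A \<times> S)" by (auto simp: set_Cons_def)
  moreover have "inj_on (\<lambda>(x, xs). x # xs) (A \<times> S)" by (auto simp: inj_on_def)
  ultimately show ?thesis by (simp add: sum.reindex sum.cartesian_product case_prod_unfold)
qed

lemma multilinear_ext_eq_component_sum:
  "multilinear_ext G (\<lambda>ps xs. f (zip ps xs)) xs = component_sum G f xs"
proof (induction xs arbitrary: f)
  case (Cons x xs)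
  show ?case
    by (simp add: multilinear_ext_def sum_set_Cons flip: Cons)
qed (simp add: multilinear_ext_def)

lemma multilinear_ext_cong:
  assumes "\<And>ps ys. length ps = length xs \<Longrightarrow> length ys = length xs \<Longrightarrow> F ps ys = F' ps ys"
  shows "multilinear_ext G F xs = multilinear_ext G F' xs"
proof -
  have "length ps = length Ss" if "ps \<in> listset Ss" for ps :: "int list" and Ss
    using that by (induction Ss arbitrary: ps) (auto simp: set_Cons_def)
  then show ?thesis
    unfolding multilinear_ext_def by (intro sum.cong refl assms) auto
qed

context graded_module
begin

text \<open>Additivity and compatibility with scalars in one condition.\<close>

definition slotwise_linear :: "((int \<times> 'a) list \<Rightarrow> 'a) \<Rightarrow> bool" where
  "slotwise_linear f \<longleftrightarrow> (\<forall>us vs p c v w.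
     f (us @ (p, scale c v + w) # vs) = scale c (f (us @ (p, v) # vs)) + f (us @ (p, w) # vs))"

lemma slotwise_linear_Cons: "slotwise_linear f \<Longrightarrow> slotwise_linear (\<lambda>l. f (z # l))"
  unfolding slotwise_linear_def by (metis append_Cons)

lemma slotwise_linear_zero: "slotwise_linear f \<Longrightarrow> f (us @ (p, 0) # vs) = 0"
  unfolding slotwise_linear_def by (metis add_cancel_right_right scale_one scale_zero_right)

lemma component_sum_slot:
  assumes "\<And>l. f l = scale c (g l) + h l"
  shows "component_sum G f xs = scale c (component_sum G g xs) + component_sum G h xs"
  using assms
proof (induction xs arbitrary: f g h)
  case (Cons x xs)
  have "component_sum G (\<lambda>l. f ((p, hcomp G x p) # l)) xs =
      scale c (component_sum G (\<lambda>l. g ((p, hcomp G x p) # l)) xs) +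
      component_sum G (\<lambda>l. h ((p, hcomp G x p) # l)) xs" for p
    by (rule Cons.IH) (rule Cons.prems)
  then show ?case by (simp add: sum.distrib scale_sum_right)
qed simp

text \<open>The components of \<open>c x + y\<close> and of its two summands are all summed over a common finite set of
  degrees; the additional terms vanish as \<open>f\<close> is linear.\<close>

lemma component_sum_linear:
  assumes "slotwise_linear f" "x \<in> M" "y \<in> M"
  shows "component_sum G f (us @ (scale c x + y) # vs) =
    scale c (component_sum G f (us @ x # vs)) + component_sum G f (us @ y # vs)"
  using assms(1)
proof (induction us arbitrary: f)
  case Nil
  define g where "g = (\<lambda>p v. component_sum G (\<lambda>l. f ((p, v) # l)) vs)"
  have g: "g p (scale a v + w) = scale a (g p v) + g p w" for p a v w
    unfolding g_def using Nil[unfolded slotwise_linear_def, rule_format, of "[]"]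
    by (intro component_sum_slot) simp
  have g0: "g p 0 = 0" for p using g[of p 1 0 0] by simp
  let ?S = "{p. hcomp G x p \<noteq> 0} \<union> {p. hcomp G y p \<noteq> 0}"
  have S: "finite ?S" using hcomp_decomposition(2) assms by simp
  have *: "(\<Sum>p | hcomp G v p \<noteq> 0. g p (hcomp G v p)) = (\<Sum>p\<in>?S. g p (hcomp G v p))"
    if "{p. hcomp G v p \<noteq> 0} \<subseteq> ?S" for v
    using S that by (intro sum.mono_neutral_left) (auto simp: g0)
  have "{p. hcomp G (scale c x + y) p \<noteq> 0} \<subseteq> ?S"
    by (auto simp: hcomp_linear[OF assms(2,3)])
  then have "(\<Sum>p | hcomp G (scale c x + y) p \<noteq> 0. g p (hcomp G (scale c x + y) p)) =
    scale c (\<Sum>p | hcomp G x p \<noteq> 0. g p (hcomp G x p)) + (\<Sum>p | hcomp G y p \<noteq> 0. g p (hcomp G y p))"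
    by (subst (1 2 3) *) (auto simp: hcomp_linear[OF assms(2,3)] g sum.distrib scale_sum_right)
  then show ?case by (simp add: g_def)
next
  case (Cons z us)
  show ?case
    by (simp add: Cons.IH[OF slotwise_linear_Cons[OF Cons.prems]] sum.distrib scale_sum_right)
qed

lemma component_sum_homogeneous:
  assumes "slotwise_linear f" "list_all2 (\<lambda>p x. x \<in> G p) ps xs"
  shows "component_sum G f xs = f (zip ps xs)"
  unfolding multilinear_ext_eq_component_sum[symmetric]
proof (rule multilinear_ext_homogeneous[OF assms(2)])
  assume "0 \<in> set xs"
  then obtain i where "i < length xs" "xs ! i = 0" by (auto simp: in_set_conv_nth)
  moreover from this have "zip ps xs = take i (zip ps xs) @ (ps ! i, 0) # drop (Suc i) (zip ps xs)"
    using list_all2_lengthD[OF assms(2)] by (subst id_take_nth_drop[of i]) simp_all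
  ultimately show "f (zip ps xs) = 0"
    using slotwise_linear_zero[OF assms(1)] by metis
qed

lemma component_sum_homogeneous_Cons:
  assumes "slotwise_linear f" "x \<in> G p"
  shows "component_sum G f (x # xs) = component_sum G (\<lambda>l. f ((p, x) # l)) xs"
proof (cases "x = 0")
  case True
  have "f ((p, 0) # l) = scale 0 0 + 0" for l using slotwise_linear_zero[OF assms(1), of "[]"] by simp
  then have "component_sum G (\<lambda>l. f ((p, 0) # l)) xs = scale 0 (component_sum G (\<lambda>l. 0) xs) + component_sum G (\<lambda>l. 0) xs"
    by (rule component_sum_slot) 
  also have "component_sum G (\<lambda>l. 0) xs = 0" by (induction xs) simp_all
  finally show ?thesis using True hcomp_homogeneous[OF assms(2)] by simp
next
  case False
  then have "{q. (if q = p then x else 0) \<noteq> 0} = {p}" by auto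
  then show ?thesis by (simp add: hcomp_homogeneous[OF assms(2)])
qed

lemma component_sum_antisym:
  assumes "slotwise_linear f" "a \<in> G p" "b \<in> G q"
    and "\<And>us vs. f (us @ [(p, a), (q, b)] @ vs) + signed (p * q) (f (us @ [(q, b), (p, a)] @ vs)) = 0"
  shows "component_sum G f (us @ [a, b] @ vs) + signed (p * q) (component_sum G f (us @ [b, a] @ vs)) = 0"
  using assms(1,4)
proof (induction us arbitrary: f)
  case Nil
  have eq: "f ((p, a) # (q, b) # l) = scale (- msign (p * q)) (f ((q, b) # (p, a) # l)) + 0" for l
    using Nil(2)[of "[]" l] by (simp add: scale_msign eq_neg_iff_add_eq_0)
  have "component_sum G (\<lambda>l. 0) xs = 0" for xs by (induction xs) simp_all
  then have "component_sum G (\<lambda>l. f ((p, a) # (q, b) # l)) vs =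
    - signed (p * q) (component_sum G (\<lambda>l. f ((q, b) # (p, a) # l)) vs)"
    by (subst component_sum_slot[OF eq]) (simp add: scale_msign)
  then show ?case
    using Nil(1) assms(2,3)
    by (simp add: component_sum_homogeneous_Cons slotwise_linear_Cons del: component_sum.simps)
next
  case (Cons z us)
  have "component_sum G (\<lambda>l. f ((r, v) # l)) (us @ [a, b] @ vs) +
      signed (p * q) (component_sum G (\<lambda>l. f ((r, v) # l)) (us @ [b, a] @ vs)) = 0" for r v
    by (rule Cons.IH[OF slotwise_linear_Cons[OF Cons.prems(1)]]) (use Cons.prems(2)[of "(r, v) # _"] in simp)
  then show ?case by (simp add: signed_sum flip: sum.distrib)
qed

lemma component_sum_mem:
  assumes "subspace S" "\<And>l. f l \<in> S"
  shows "component_sum G f xs \<in> S"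
  using assms(2)
  by (induction xs arbitrary: f) (auto intro!: subspace_sum[OF assms(1)])

end

section \<open>The transferred structure\<close>

context dg_lie_contraction
begin

text \<open>\<open>[d,\<eta>]\<close> has degree \<open>0\<close>, so it acts on every homogeneous component separately. Hence the components of
  a harmonic element are harmonic.\<close>

lemma comm_hcomp: "comm_d_eta d \<eta> x = 0 \<Longrightarrow> comm_d_eta d \<eta> (hcomp G x p) = 0"
proof -
  assume x: "comm_d_eta d \<eta> x = 0"
  note dec = hcomp_decomposition[of x, simplified]
  let ?S = "{p. hcomp G x p \<noteq> 0}"
  interpret add: additive "comm_d_eta d \<eta>" by standard (simp add: comm_d_eta_def hom_simps)
  have "comm_d_eta d \<eta> x = (\<Sum>p\<in>?S. comm_d_eta d \<eta> (hcomp G x p))"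
    by (subst dec(3)) (rule add.sum)
  moreover have "comm_d_eta d \<eta> v \<in> G p" if "v \<in> G p" for v p
    using d_degree[OF eta_degree[OF that]] eta_degree[OF d_degree[OF that]]
    by (simp add: comm_d_eta_def degree_simps)
  ultimately have "hcomp G (comm_d_eta d \<eta> x) = (\<lambda>p. comm_d_eta d \<eta> (hcomp G x p))"
    using dec(1,2) by (intro hcomp_unique[of _ ?S]) (auto simp: add.zero)
  moreover have "hcomp G 0 = (\<lambda>p. 0)"
    by (rule hcomp_unique[of 0 "{}"]) (simp_all add: degree_simps)
  ultimately show ?thesis unfolding x by metis
qed

lemma harmonic_eq: "harmonic d \<eta> = {x. comm_d_eta d \<eta> x = 0}"
  by (simp add: harmonic_def)

lemma subspace_harmonic: "subspace (harmonic d \<eta>)"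
  by (auto simp: subspace_def harmonic_iff hom_simps)

lemma graded_module_harmonic: "graded_module scale (harmonic d \<eta>) (\<lambda>p. harmonic d \<eta> \<inter> G p)"
proof unfold_locales
  fix x assume x: "x \<in> harmonic d \<eta>"
  show "\<exists>!c. (\<forall>p. c p \<in> harmonic d \<eta> \<inter> G p) \<and> finite {p. c p \<noteq> 0} \<and> x = (\<Sum>p | c p \<noteq> 0. c p)"
  proof (rule ex1I[of _ "hcomp G x"])
    show "(\<forall>p. hcomp G x p \<in> harmonic d \<eta> \<inter> G p) \<and> finite {p. hcomp G x p \<noteq> 0} \<and> x = (\<Sum>p | hcomp G x p \<noteq> 0. hcomp G x p)"
      using hcomp_decomposition[of x] x comm_hcomp[of x] by (simp add: harmonic_eq)
  next
    fix c assume "(\<forall>p. c p \<in> harmonic d \<eta> \<inter> G p) \<and> finite {p. c p \<noteq> 0} \<and> x = (\<Sum>p | c p \<noteq> 0. c p)"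
    then show "c = hcomp G x" by (intro hcomp_unique[symmetric, of _ "{p. c p \<noteq> 0}"]) auto
  qed
qed (auto simp: subspace_harmonic subspace_degree intro: subspace_inter)

text \<open>A closed \<open>x\<close> differs from \<open>proj x\<close> by the boundary of \<open>\<eta> x\<close>. If two harmonic elements differ by
  \<open>d z\<close>, then \<open>\<eta> (d z) = 0\<close> and so \<open>d z = d (\<eta> (d z)) = 0\<close>.\<close>

lemma bij_betw_cohomology: "bij_betw (\<lambda>x. cohomologous d `` {x}) (harmonic d \<eta>) (cohomology d)"
proof -
  have equiv: "equiv {x. d x = 0} (cohomologous d)"
  proof (rule equivI)
    show "refl_on {x. d x = 0} (cohomologous d)"
      using hom_simps(5) by (force simp: refl_on_def cohomologous_def image_iff)
    show "sym (cohomologous d)"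
    proof (rule symI)
      fix x y assume "(x, y) \<in> cohomologous d"
      then obtain z where "d x = 0" "d y = 0" "x - y = d z" by (auto simp: cohomologous_def)
      then have "y - x = d (- z)" by (simp add: hom_simps) (metis minus_diff_eq)
      then show "(y, x) \<in> cohomologous d" using \<open>d x = 0\<close> \<open>d y = 0\<close> by (simp add: cohomologous_def)
    qed
    show "trans (cohomologous d)"
    proof (rule transI)
      fix x y u assume "(x, y) \<in> cohomologous d" "(y, u) \<in> cohomologous d"
      then obtain z z' where z: "d x = 0" "d u = 0" "x - y = d z" "y - u = d z'" by (auto simp: cohomologous_def)
      have "x - u = (x - y) + (y - u)" by simp
      then have "x - u = d (z + z')" using z by (simp only: hom_simps)
      then show "(x, u) \<in> cohomologous d" using z by (simp add: cohomologous_def)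
    qed
    show "cohomologous d \<subseteq> {x. d x = 0} \<times> {x. d x = 0}" by (auto simp: cohomologous_def)
  qed
  show ?thesis
  proof (rule bij_betw_imageI)
    show "inj_on (\<lambda>x. cohomologous d `` {x}) (harmonic d \<eta>)"
    proof (rule inj_onI)
      fix x y assume xy: "x \<in> harmonic d \<eta>" "y \<in> harmonic d \<eta>" "cohomologous d `` {x} = cohomologous d `` {y}"
      then have "(x, y) \<in> cohomologous d"
        using eq_equiv_class[OF _ equiv, of x y] by (simp add: harmonic_iff)
      then obtain z where z: "x - y = d z" by (auto simp: cohomologous_def)
      have "\<eta> (x - y) = 0" using xy by (simp add: harmonic_iff hom_simps)
      then have "d (\<eta> (d z)) = 0" unfolding z by (simp add: hom_simps)
      then show "x = y" using z by (simp add: d_eta_d)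
    qed
    show "(\<lambda>x. cohomologous d `` {x}) ` harmonic d \<eta> = cohomology d"
    proof (intro equalityI subsetI)
      fix C assume "C \<in> (\<lambda>x. cohomologous d `` {x}) ` harmonic d \<eta>"
      then show "C \<in> cohomology d" by (auto simp: cohomology_def harmonic_iff intro: quotientI)
    next
      fix C assume "C \<in> cohomology d"
      then obtain x where x: "d x = 0" "C = cohomologous d `` {x}"
        by (auto simp: cohomology_def elim: quotientE)
      have "x - proj x = d (\<eta> x)" using x by (simp add: proj_def comm_d_eta_def hom_simps)
      then have "(x, proj x) \<in> cohomologous d" using x by (simp add: cohomologous_def d_proj)
      then have "C = cohomologous d `` {proj x}" unfolding x by (rule equiv_class_eq[OF equiv])
      then show "C \<in> (\<lambda>x. cohomologous d `` {x}) ` harmonic d \<eta>" using proj_harmonic by blast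
    qed
  qed
qed

abbreviation transferred_map :: "nat \<Rightarrow> 'a list \<Rightarrow> 'a" where
  "transferred_map \<equiv> transferred \<iota> scale G d \<eta> br"

lemma slotwise_linear_mu: "slotwise_linear mu"
  by (simp add: slotwise_linear_def mu_linear)

lemma transferred_eq_component_sum:
  assumes "length xs = n" "n \<ge> 1"
  shows "transferred_map n xs = component_sum G mu xs"
proof (cases "n \<ge> 2")
  case True
  then have "transferred_map n xs = multilinear_ext G (\<lambda>ps xs. mu (zip ps xs)) xs"
    unfolding transferred_def if_P[OF True]
    by (intro multilinear_ext_cong transferred_summand_eq_mu) (simp_all add: assms)
  then show ?thesis by (simp only: multilinear_ext_eq_component_sum)
next
  case False
  then obtain x where "xs = [x]" using assms by (cases xs; cases "tl xs") auto
  then show ?thesis using False by (simp add: transferred_def mu_short)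
qed

lemma transferred_homogeneous:
  assumes "list_all2 (\<lambda>p x. x \<in> G p) ps xs" "length xs = n" "n \<ge> 1"
  shows "transferred_map n xs = mu (zip ps xs)"
  using assms by (simp add: transferred_eq_component_sum component_sum_homogeneous[OF slotwise_linear_mu])

lemma additive_maps: "additive (\<lambda>x. br x y)" "additive (br x)" "additive proj" "additive d"
  by (simp_all add: additive_def hom_simps proj_simps)

lemma br_components:
  "br x y = (\<Sum>p | hcomp G x p \<noteq> 0. \<Sum>q | hcomp G y q \<noteq> 0. br (hcomp G x p) (hcomp G y q))"
proof -
  have "br x y = br (\<Sum>p | hcomp G x p \<noteq> 0. hcomp G x p) (\<Sum>q | hcomp G y q \<noteq> 0. hcomp G y q)"
    by (simp only: hcomp_decomposition(3)[OF UNIV_I, symmetric])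
  also have "\<dots> = (\<Sum>p | hcomp G x p \<noteq> 0. br (hcomp G x p) (\<Sum>q | hcomp G y q \<noteq> 0. hcomp G y q))"
    by (rule additive.sum[OF additive_maps(1)])
  finally show ?thesis by (simp only: additive.sum[OF additive_maps(2)])
qed

lemma transferred_2: "transferred_map 2 [x, y] = proj (br x y)"
proof -
  have "mu [(p, hcomp G x p), (q, hcomp G y q)] = proj (br (hcomp G x p) (hcomp G y q))" for p q
    by (intro mu_pair hcomp_decomposition(1) UNIV_I)
  then have "transferred_map 2 [x, y] =
      (\<Sum>p | hcomp G x p \<noteq> 0. \<Sum>q | hcomp G y q \<noteq> 0. proj (br (hcomp G x p) (hcomp G y q)))"
    by (simp add: transferred_eq_component_sum)
  then show ?thesis
    by (subst br_components) (simp only: additive.sum[OF additive_maps(3)])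
qed

lemma d_br_harmonic:
  assumes "x \<in> harmonic d \<eta>" "y \<in> harmonic d \<eta>"
  shows "d (br x y) = 0"
proof -
  have closed: "d (hcomp G v p) = 0" if "v \<in> harmonic d \<eta>" for v p
    using that comm_hcomp[of v p] harmonic_iff[of "hcomp G v p"] by (simp add: harmonic_eq)
  have "d (br (hcomp G x p) (hcomp G y q)) = 0" for p q
    using leibniz[OF hcomp_decomposition(1)[OF UNIV_I] hcomp_decomposition(1)[OF UNIV_I], of x p y q]
    by (simp add: closed[OF assms(1)] closed[OF assms(2)] hom_simps)
  then show ?thesis
    by (subst br_components) (simp add: additive.sum[OF additive_maps(4)])
qed

text \<open>The sum over \<open>k\<close> and over the shuffles is the sum over all unshuffles. These include the ones
  with \<open>A\<close> empty, whose terms vanish because \<open>mu []\<close> does.\<close>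

lemma transferred_relation:
  assumes n: "n \<ge> 1" and ps: "length ps = n" and as: "list_all2 (\<lambda>p a. a \<in> harmonic d \<eta> \<inter> G p) ps as"
  shows "(\<Sum>(k, l) \<in> {(k, l). k \<ge> 1 \<and> l \<ge> 1 \<and> k + l = n + 1}. \<Sum>\<sigma> \<in> Sh k n.
         scale ((- 1) ^ (k * (l - 1)) * wedge_sign \<sigma> ps)
           (transferred_map l (transferred_map k (take k (permute_list \<sigma> as)) # drop k (permute_list \<sigma> as)))) = 0"
proof -
  have len_as: "length as = n" using ps as by (simp add: list_all2_lengthD)
  define e where "e = (\<lambda>i. (ps ! i, as ! i))"
  have e: "as ! i \<in> harmonic d \<eta>" "as ! i \<in> G (ps ! i)" if "i < n" for i
    using as that ps by (auto simp: list_all2_conv_all_nth)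
  define h where "h = (\<lambda>A B. signed (len A * len B) (mu (mu_arg A # B)))"
  have hl: "harmonic_list (map e [0..<n])"
    using e by (auto simp: harmonic_list_def homogeneous_def e_def)
  have summand: "scale ((- 1) ^ (k * (l - 1)) * wedge_sign \<sigma> ps)
      (transferred_map l (transferred_map k (take k (permute_list \<sigma> as)) # drop k (permute_list \<sigma> as))) =
    signed (inversion_exponent (\<lambda>i. fst (e i)) (map \<sigma> [0..<n]))
      (h (take k (map e (map \<sigma> [0..<n]))) (drop k (map e (map \<sigma> [0..<n]))))"
    if kl: "k \<ge> 1" "l \<ge> 1" "k + l = n + 1" and \<sigma>: "\<sigma> \<in> Sh k n" for k l \<sigma>
  proof -
    define A where "A = take k (map e (map \<sigma> [0..<n]))"
    define B where "B = drop k (map e (map \<sigma> [0..<n]))"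
    have "\<sigma> i < n" if "i < n" for i
      using \<sigma> that permutes_in_image[of \<sigma> "{..<n}" i] by (simp add: Sh_def)
    then have "harmonic_list (map e (map \<sigma> [0..<n]))"
      using e by (auto simp: harmonic_list_def homogeneous_def e_def)
    then have AB: "homogeneous A" "homogeneous B" "length A = k" "length B = l - 1"
      using kl set_take_subset[of k "map e (map \<sigma> [0..<n])"] set_drop_subset[of k "map e (map \<sigma> [0..<n])"]
      unfolding A_def B_def harmonic_list_def homogeneous_def by (blast, blast, simp_all)
    have hom: "list_all2 (\<lambda>p x. x \<in> G p) (map fst C) (map snd C)" if "homogeneous C" for C
      using that by (induction C) (auto simp: homogeneous_def)
    have snd: "take k (permute_list \<sigma> as) = map snd A" "drop k (permute_list \<sigma> as) = map snd B"
      by (simp_all add: A_def B_def permute_list_def len_as e_def comp_def take_map drop_map)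
    have 1: "transferred_map k (map snd A) = mu A"
      using transferred_homogeneous[OF hom[OF AB(1)]] AB(3) kl by (simp add: zip_map_fst_snd)
    have "homogeneous (mu_arg A # B)" using AB mu_arg_degree by (simp add: homogeneous_simps)
    from transferred_homogeneous[OF hom[OF this], of l]
    have 2: "transferred_map l (mu A # map snd B) = mu (mu_arg A # B)"
      using AB(4) kl by (simp add: mu_arg_def zip_map_fst_snd)
    have "(- 1 :: 'k) ^ (k * (l - 1)) = msign (len A * len B)"
      by (auto simp: msign_def AB uminus_power_if)
    moreover have "wedge_sign \<sigma> ps = (msign (inversion_exponent (\<lambda>i. fst (e i)) (map \<sigma> [0..<n])) :: 'k)"
      using wedge_sign_inversion_exponent[OF ps] by (simp add: e_def)
    ultimately show ?thesis
      unfolding snd 1 2 A_def[symmetric] B_def[symmetric] h_def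
      by (simp add: scale_msign signed_signed add.commute flip: scale_scale)
  qed
  have "(\<Sum>(k, l) \<in> {(k, l). k \<ge> 1 \<and> l \<ge> 1 \<and> k + l = n + 1}. \<Sum>\<sigma> \<in> Sh k n.
         scale ((- 1) ^ (k * (l - 1)) * wedge_sign \<sigma> ps)
           (transferred_map l (transferred_map k (take k (permute_list \<sigma> as)) # drop k (permute_list \<sigma> as)))) =
    (\<Sum>(k, l) \<in> {(k, l). k \<ge> 1 \<and> l \<ge> 1 \<and> k + l = n + 1}.
      unshuffle_sum (\<lambda>A B. if length A = k then h A B else 0) (map e [0..<n]))"
  proof (intro sum.cong refl, clarify)
    fix k l assume kl: "1 \<le> k" "1 \<le> l" "k + l = n + 1"
    show "(\<Sum>\<sigma> \<in> Sh k n. scale ((- 1) ^ (k * (l - 1)) * wedge_sign \<sigma> ps)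
           (transferred_map l (transferred_map k (take k (permute_list \<sigma> as)) # drop k (permute_list \<sigma> as)))) =
      unshuffle_sum (\<lambda>A B. if length A = k then h A B else 0) (map e [0..<n])"
    proof -
      have "k \<le> n" using kl by simp
      show ?thesis
        unfolding sum_Sh_eq_unshuffle_sum[OF \<open>k \<le> n\<close>, symmetric]
        by (intro sum.cong refl summand kl)
    qed
  qed
  also have "\<dots> = (\<Sum>k\<in>{1..n}. unshuffle_sum (\<lambda>A B. if length A = k then h A B else 0) (map e [0..<n]))"
    by (rule sum.reindex_bij_witness[of _ "\<lambda>k. (k, n + 1 - k)" fst]) auto
  also have "\<dots> = unshuffle_sum (\<lambda>A B. \<Sum>k\<in>{1..n}. if length A = k then h A B else 0) (map e [0..<n])"
  proof -
    have "(\<Sum>k\<in>K. unshuffle_sum (\<lambda>A B. g k A B) l) = unshuffle_sum (\<lambda>A B. \<Sum>k\<in>K. g k A B) l"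
      if "finite K" for K :: "nat set" and g and l :: "(int \<times> 'a) list"
      using that by (induction K) (simp_all add: unshuffle_sum_add)
    from this[OF finite_atLeastAtMost] show ?thesis .
  qed
  also have "\<dots> = unshuffle_sum h (map e [0..<n])"
  proof (rule unshuffle_sum_cong)
    fix A B assume AB: "mset A + mset B = mset (map e [0..<n])"
    have "h [] B = 0"
      using slotwise_linear_zero[OF slotwise_linear_mu, of "[]"] by (simp add: h_def mu_arg_def mu_short)
    then show "(\<Sum>k\<in>{1..n}. if length A = k then h A B else 0) = h A B"
      using unshuffle_parts(4)[OF AB] by (cases "A = []") (auto simp: sum.delta' Suc_le_eq)
  qed
  also have "\<dots> = 0" unfolding h_def by (rule mu_relation[OF hl])
  finally show ?thesis .
qed

lemma L_infinity_harmonic: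
  "L_infinity_algebra scale (harmonic d \<eta>) (\<lambda>p. harmonic d \<eta> \<inter> G p) transferred_map"
proof -
  interpret H: graded_module scale "harmonic d \<eta>" "\<lambda>p. harmonic d \<eta> \<inter> G p"
    by (rule graded_module_harmonic)
  show ?thesis
  proof unfold_locales
    fix xs show "transferred_map 0 xs = 0" by (simp add: transferred_def)
  next
    fix n :: nat assume n: "1 \<le> n"
    note T = transferred_eq_component_sum[OF _ n]
    note lin = component_sum_linear[OF slotwise_linear_mu UNIV_I UNIV_I]
    have zero: "component_sum G mu (us @ 0 # vs) = 0" for us vs
      using lin[of us 1 0 0 vs] by simp
    show "multilinear_on scale (harmonic d \<eta>) n (transferred_map n)"
      unfolding multilinear_on_def
    proof (intro conjI allI impI; elim conjE)
      fix xs assume "length xs = n" "set xs \<subseteq> harmonic d \<eta>"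
      then show "transferred_map n xs \<in> harmonic d \<eta>"
        by (simp add: T component_sum_mem[OF subspace_harmonic mu_harmonic])
    next
      fix us vs :: "'a list" and x y assume "length us + length vs + 1 = n"
      then show "transferred_map n (us @ (x + y) # vs) = transferred_map n (us @ x # vs) + transferred_map n (us @ y # vs)"
        using lin[of us 1 x y vs] by (simp add: T)
    next
      fix us vs :: "'a list" and x c assume "length us + length vs + 1 = n"
      then show "transferred_map n (us @ scale c x # vs) = scale c (transferred_map n (us @ x # vs))"
        using lin[of us c x 0 vs] by (simp add: T zero)
    qed
    show "has_degree (\<lambda>p. harmonic d \<eta> \<inter> G p) n (2 - int n) (transferred_map n)"
      unfolding has_degree_def
    proof (intro allI impI; elim conjE)
      fix ps xs assume ps: "length ps = n" "list_all2 (\<lambda>p x. x \<in> harmonic d \<eta> \<inter> G p) ps xs"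
      then have xs: "list_all2 (\<lambda>p x. x \<in> G p) ps xs" by (auto elim: list_all2_mono)
      then have len: "length xs = n" using ps by (simp add: list_all2_lengthD)
      have "homogeneous (zip ps xs)"
        using xs by (auto simp: homogeneous_def list_all2_iff)
      moreover have "shifted_deg (zip ps xs) + 1 = sum_list ps + (2 - int n)"
        using ps len by (simp add: shifted_deg_def deg_def)
      ultimately have "mu (zip ps xs) \<in> G (sum_list ps + (2 - int n))"
        by (metis mu_degree)
      then show "transferred_map n xs \<in> harmonic d \<eta> \<inter> G (sum_list ps + (2 - int n))"
        using mu_harmonic by (simp add: transferred_homogeneous[OF xs len n])
    qed
    show "graded_antisym scale (harmonic d \<eta>) (\<lambda>p. harmonic d \<eta> \<inter> G p) n (transferred_map n)"
      unfolding graded_antisym_def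
    proof (intro allI impI; elim conjE)
      fix us vs :: "'a list" and p q a b
      assume "length us + length vs + 2 = n" and ab: "a \<in> harmonic d \<eta> \<inter> G p" "b \<in> harmonic d \<eta> \<inter> G q"
      then have "length (us @ [a, b] @ vs) = n" "length (us @ [b, a] @ vs) = n" by simp_all
      moreover have "component_sum G mu (us @ [a, b] @ vs) + signed (p * q) (component_sum G mu (us @ [b, a] @ vs)) = 0"
        using ab mu_antisym[of _ "(p, a)" "(q, b)"]
        by (intro component_sum_antisym slotwise_linear_mu) simp_all
      ultimately show "transferred_map n (us @ [a, b] @ vs) + scale (msign (p * q)) (transferred_map n (us @ [b, a] @ vs)) = 0"
        unfolding scale_msign by (simp only: T)
    qed
  qed (rule transferred_relation)
qed

end

theorem theorem3p5:
  fixes \<iota> :: "rat \<Rightarrow> 'k::{comm_ring_1, ring_char_0}"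
    and scale :: "'k \<Rightarrow> 'a::ab_group_add \<Rightarrow> 'a"
    and G :: "int \<Rightarrow> 'a set"
    and d \<eta> :: "'a \<Rightarrow> 'a"
    and br :: "'a \<Rightarrow> 'a \<Rightarrow> 'a"
  assumes "rat_embedding \<iota>"
    and "dg_lie_algebra scale G d br"
    and "module_hom scale scale \<eta>"
    and "\<And>p x. x \<in> G p \<Longrightarrow> \<eta> x \<in> G (p - 1)"
    and "\<And>x. d (\<eta> (d x)) = d x"
    and "\<And>x. \<eta> (\<eta> x) = 0"
    and "\<And>x. \<eta> (d (\<eta> x)) = \<eta> x"
  shows "harmonic d \<eta> = {x. comm_d_eta d \<eta> x = 0} \<and>
    bij_betw (\<lambda>x. cohomologous d `` {x}) (harmonic d \<eta>) (cohomology d) \<and>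
    (\<forall>x \<in> harmonic d \<eta>. transferred \<iota> scale G d \<eta> br 1 [x] = 0) \<and>
    (\<forall>x \<in> harmonic d \<eta>. \<forall>y \<in> harmonic d \<eta>.
       transferred \<iota> scale G d \<eta> br 2 [x, y] = br x y - d (\<eta> (br x y))) \<and>
    L_infinity_algebra scale (harmonic d \<eta>) (\<lambda>p. harmonic d \<eta> \<inter> G p)
      (transferred \<iota> scale G d \<eta> br)"
proof -
  interpret dg_lie_contraction scale G d br \<iota> \<eta>
    using assms by (intro dg_lie_contraction.intro dg_lie_contraction_axioms.intro)
  have "transferred \<iota> scale G d \<eta> br 2 [x, y] = br x y - d (\<eta> (br x y))"
    if "x \<in> harmonic d \<eta>" "y \<in> harmonic d \<eta>" for x y
    unfolding transferred_2 proj_def comm_d_eta_def d_br_harmonic[OF that] by (simp add: hom_simps)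
  moreover have "transferred \<iota> scale G d \<eta> br 1 [x] = 0" for x
    by (simp add: transferred_def)
  ultimately show ?thesis
    using harmonic_eq bij_betw_cohomology L_infinity_harmonic by blast
qed

end
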